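(* Let $M,N\ge1$ with $M\asymp N$ (i.e. $C_1N\le M\le C_2N$ for fixed $C_1,C_2>0$), $q\in\mathbf{N}$, and $K\ge N^{\eta}$ for some $\eta>0$. Assume $q\le N^{2-\delta}$ for some $\delta>0$. Then for any $\epsilon>0$, \[ \sum_{\substack{1\le\rho\le q\\(\rho,q)=1}}\Big(\sum_{r\le K}\ \sum_{m\equiv\rho r\ (\mathrm{mod}\ q)}\tau_{M,N}(m)-\frac{KMN}{q}\Big)^2\ll\frac{K^2N^4}{q}\Big(q^{\epsilon}\Big(\frac1q+\frac1K\Big)^2+N^{\max(-1/2,-\delta)+\epsilon}\Big). \]
   Context: $\tau_{M,N}(m)=\#\{(a,b)\in\mathbf{N}^2: a\le M,\ b\le N,\ ab=m\}$; $r$ and $m$ range over positive integers; $\rho$ ranges over reduced residues modulo $q$. *)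

theory Defs
  imports "HOL-Analysis.Analysis" "HOL-Number_Theory.Number_Theory"
begin

definition tau_box :: "real \<Rightarrow> real \<Rightarrow> nat \<Rightarrow> nat" where
  "tau_box M N m =
     card {(a, b). 0 < a \<and> 0 < b \<and> real a \<le> M \<and> real b \<le> N \<and> a * b = m}"

text \<open>The sum over \<open>m\<close> is written over the whole residue class; it has finite support,
  since \<open>tau_box M N m = 0\<close> once \<open>m > M * N\<close>.\<close>

definition tau_progression_sum :: "real \<Rightarrow> real \<Rightarrow> real \<Rightarrow> nat \<Rightarrow> nat \<Rightarrow> real" where
  "tau_progression_sum M N K q \<rho> =
     (\<Sum>r | 0 < r \<and> real r \<le> K.
        \<Sum>\<^sub>\<infinity>m\<in>{m. 0 < m \<and> [m = \<rho> * r] (mod q)}. real (tau_box M N m))"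

end

theory Submission imports Defs begin

text \<open>
Write \<open>T x\<close> for the number of pairs \<open>a \<le> M\<close>, \<open>b \<le> N\<close> with \<open>a b \<equiv> x\<close> modulo \<open>q\<close>, and let
\<open>T\<^sub>0 x\<close> be the count obtained by replacing, for each \<open>a\<close>, the number of admissible \<open>b\<close> by its
expected value; \<open>T\<^sub>0\<close> depends only on \<open>gcd x q\<close>. Summing \<open>T\<^sub>0 (\<rho> r)\<close> over \<open>r \<le> K\<close> gives
\<open>K M N / q\<close> up to \<open>O (M N d(q) / q + K (M + N) / q)\<close>. By Cauchy-Schwarz the sum over \<open>r\<close>
may be taken trivially for the rest, so it suffices that the sum over \<open>x\<close> of \<open>(T x - T\<^sub>0 x)\<^sup>2\<close>
is at most \<open>N\<close> to the power \<open>2 + \<epsilon>\<close>.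

By Parseval this is the mean square over \<open>h\<close> of the sum over \<open>a \<le> M\<close> with \<open>q\<close> not dividing \<open>h a\<close>, of the
geometric sums over \<open>b\<close>, each bounded by \<open>min N (q / \<bar>u\<bar>)\<close> with \<open>u \<equiv> h a\<close>. Opening the square
and putting \<open>v \<equiv> h a'\<close> one has \<open>a v \<equiv> a' u\<close>. For fixed \<open>a'\<close> and \<open>u\<close>, the pairs \<open>(a, v)\<close> are
counted through the product \<open>n = a v\<close>, which runs through a residue class modulo \<open>q\<close> and has few
divisors; the weight of \<open>v\<close> is at most \<open>min N (q M / n)\<close>.
\<close>

subsection \<open>Divisor and harmonic bounds\<close>

definition divisor_count :: "nat \<Rightarrow> nat" where
  "divisor_count n = card {d. d dvd n}"

text \<open>Each divisor splits as \<open>p ^ i * e\<close> with \<open>i \<le> k\<close> and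
  \<open>e dvd m\<close>. The splitting need not be unique, which does no harm to an upper
  bound.\<close>

lemma divisor_count_prime_power_mult_le:
  fixes p k m :: nat
  assumes "prime p" "m > 0"
  shows "divisor_count (p ^ k * m) \<le> (k + 1) * divisor_count m"
proof -
  have "{d. d dvd p ^ k * m} \<subseteq> (\<lambda>(i, e). p ^ i * e) ` ({..k} \<times> {e. e dvd m})"
  proof
    fix d assume "d \<in> {d. d dvd p ^ k * m}"
    then obtain x y where "d = x * y" "x dvd p ^ k" "y dvd m"
      using division_decomp by blast
    then show "d \<in> (\<lambda>(i, e). p ^ i * e) ` ({..k} \<times> {e. e dvd m})"
      using divides_primepow_nat[OF \<open>prime p\<close>] by force
  qed
  moreover have "finite ({..k} \<times> {e. e dvd m})"
    using \<open>m > 0\<close> by auto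
  ultimately have "divisor_count (p ^ k * m) \<le> card ({..k} \<times> {e. e dvd m})"
    unfolding divisor_count_def by (meson surj_card_le)
  then show ?thesis
    by (simp add: divisor_count_def card_cartesian_product)
qed

text \<open>Powers beat linear growth: \<open>1 + k * t \<le> exp (k * t)\<close> with
  \<open>t = \<epsilon> * ln 2\<close>, and the constant makes up for a small \<open>t\<close>. This
  supplies the local factor at small primes.\<close>

lemma Suc_le_const_mult_powr:
  fixes \<epsilon> x :: real
  assumes "\<epsilon> > 0" "x \<ge> 2"
  shows "real k + 1 \<le> (1 + 1 / (\<epsilon> * ln 2)) * (x ^ k) powr \<epsilon>"
proof -
  define t where "t = \<epsilon> * ln 2"
  have "t > 0" using assms by (simp add: t_def)
  have "1 + real k * t \<le> exp (real k * t)"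
    by (rule exp_ge_add_one_self)
  also have "\<dots> = (2 powr real k) powr \<epsilon>"
    by (simp add: powr_powr powr_def t_def mult_ac)
  also have "\<dots> = (2 ^ k) powr \<epsilon>"
    by (simp add: powr_realpow)
  also have "\<dots> \<le> (x ^ k) powr \<epsilon>"
    using assms by (intro powr_mono2 power_mono) auto
  finally have *: "1 + real k * t \<le> (x ^ k) powr \<epsilon>" .
  have "real k + 1 \<le> (1 + 1 / t) * (1 + real k * t)"
    using \<open>t > 0\<close> by (simp add: field_simps)
  also have "\<dots> \<le> (1 + 1 / t) * (x ^ k) powr \<epsilon>"
    using * \<open>t > 0\<close> by (intro mult_left_mono) auto
  finally show ?thesis by (simp add: t_def)
qed

text \<open>Only the finitely many primes \<open>p\<close> with \<open>p powr \<epsilon> < 2\<close> contribute a factor other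
  than \<open>1\<close> to the constant.\<close>

lemma divisor_count_le_powr:
  fixes \<epsilon> :: real
  assumes "\<epsilon> > 0"
  obtains C where "C \<ge> 1" "\<And>n. n > 0 \<Longrightarrow> real (divisor_count n) \<le> C * real n powr \<epsilon>"
proof -
  define c where "c = 1 + 1 / (\<epsilon> * ln 2)"
  define P where "P = {p::nat. prime p \<and> real p powr \<epsilon> < 2}"
  have "c \<ge> 1" using assms by (simp add: c_def)
  have "P \<subseteq> {..nat \<lceil>2 powr (1 / \<epsilon>)\<rceil>}"
  proof
    fix p assume "p \<in> P"
    then have "(real p powr \<epsilon>) powr (1 / \<epsilon>) \<le> 2 powr (1 / \<epsilon>)"
      using assms by (intro powr_mono2) (auto simp: P_def)
    then have "real p \<le> 2 powr (1 / \<epsilon>)"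
      using assms by (simp add: powr_powr)
    then show "p \<in> {..nat \<lceil>2 powr (1 / \<epsilon>)\<rceil>}"
      by (simp add: le_nat_iff) linarith
  qed
  then have "finite P" using finite_subset by blast
  \<comment> \<open>Strong induction, splitting off the full power of one prime at a time. The
    exponent of \<open>c\<close> counts the exceptional primes dividing \<open>n\<close>, so each is
    paid for once and the total is at most \<open>card P\<close>.\<close>
  have bound: "real (divisor_count n) \<le> c ^ card {p \<in> P. p dvd n} * real n powr \<epsilon>"
    if "n > 0" for n
    using that
  proof (induction n rule: less_induct)
    case (less n)
    show ?case
    proof (cases "n = 1")
      case True
      have "{p \<in> P. p dvd 1} = {}" by (auto simp: P_def)
      then show ?thesis using True by (simp only:) (simp add: divisor_count_def)
    next
      case False
      then obtain p where p: "prime p" "p dvd n" using prime_factor_nat by blast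
      define k where "k = multiplicity p n"
      obtain m where m: "n = p ^ k * m" "\<not> p dvd m"
        using multiplicity_decompose'[of n p] p less.prems unfolding k_def
        by (metis not_prime_unit gr_implies_not0)
      have "m > 0" using m less.prems by (cases m) auto
      have "k > 0" using p(2) m by (cases k) auto
      have "p ^ k > 1"
        using one_less_power[OF prime_gt_1_nat[OF p(1)] \<open>k > 0\<close>] .
      then have "m < n" using m(1) \<open>m > 0\<close> by simp
      \<comment> \<open>Local factor at \<open>p\<close>. Outside \<open>P\<close> it can be
        \<open>1\<close>, because \<open>k + 1 \<le> 2 ^ k\<close> and
        \<open>2 \<le> p powr \<epsilon>\<close>.\<close>
      define b where "b = (if p \<in> P then c else 1)"
      have "real k + 1 \<le> b * (real p ^ k) powr \<epsilon>"
      proof (cases "p \<in> P")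
        case True
        then show ?thesis
          using Suc_le_const_mult_powr[OF assms, of "real p" k] prime_ge_2_nat[OF p(1)]
          by (simp add: b_def c_def)
      next
        case False
        then have "real p powr \<epsilon> \<ge> 2" using p by (auto simp: P_def)
        have "real k + 1 \<le> 2 ^ k"
          using Suc_leI[OF less_exp[of k]] by (metis of_nat_Suc of_nat_le_iff of_nat_numeral of_nat_power add.commute)
        also have "\<dots> \<le> (real p powr \<epsilon>) ^ k"
          using \<open>real p powr \<epsilon> \<ge> 2\<close> by (intro power_mono) auto
        also have "\<dots> = (real p ^ k) powr \<epsilon>"
          using p prime_gt_0_nat[of p] by (simp add: powr_realpow[symmetric] powr_powr mult.commute)
        finally show ?thesis using False by (simp add: b_def)
      qed
      moreover have "real (divisor_count m) \<le> c ^ card {p \<in> P. p dvd m} * real m powr \<epsilon>"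
        using less.IH \<open>m < n\<close> \<open>m > 0\<close> by blast
      moreover have "b * c ^ card {p \<in> P. p dvd m} \<le> c ^ card {p \<in> P. p dvd n}"
      proof (cases "p \<in> P")
        case True
        then have "Suc (card {p \<in> P. p dvd m}) = card (insert p {p \<in> P. p dvd m})"
          using m(2) \<open>finite P\<close> by simp
        also have "\<dots> \<le> card {p \<in> P. p dvd n}"
          using True p \<open>finite P\<close> m(1) by (intro card_mono) auto
        finally show ?thesis
          using True \<open>c \<ge> 1\<close> power_increasing[of _ _ c] by (simp add: b_def flip: power_Suc)
      next
        case False
        have "card {p \<in> P. p dvd m} \<le> card {p \<in> P. p dvd n}"
          using \<open>finite P\<close> m(1) by (intro card_mono) auto
        then show ?thesis using False \<open>c \<ge> 1\<close> by (simp add: b_def power_increasing)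
      qed
      moreover have "real (divisor_count n) \<le> (real k + 1) * real (divisor_count m)"
        using divisor_count_prime_power_mult_le[OF p(1) \<open>m > 0\<close>, of k] m(1)
        by (metis of_nat_le_iff of_nat_mult of_nat_Suc Suc_eq_plus1 add.commute)
      moreover have "b \<ge> 0" using \<open>c \<ge> 1\<close> by (simp add: b_def)
      ultimately have "real (divisor_count n)
          \<le> (b * (real p ^ k) powr \<epsilon>) * (c ^ card {p \<in> P. p dvd m} * real m powr \<epsilon>)"
        by (smt (verit) mult_mono of_nat_0_le_iff zero_le_mult_iff powr_ge_zero)
      also have "\<dots> = (b * c ^ card {p \<in> P. p dvd m}) * real n powr \<epsilon>"
        by (simp add: m(1) powr_mult mult_ac)
      also have "\<dots> \<le> c ^ card {p \<in> P. p dvd n} * real n powr \<epsilon>"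
        using \<open>b * _ \<le> _\<close> by (intro mult_right_mono) auto
      finally show ?thesis .
    qed
  qed
  show ?thesis
  proof (rule that)
    show "c ^ card P \<ge> 1" using \<open>c \<ge> 1\<close> by (rule one_le_power)
    fix n :: nat assume "n > 0"
    have "c ^ card {p \<in> P. p dvd n} \<le> c ^ card P"
      using \<open>c \<ge> 1\<close> \<open>finite P\<close> by (intro power_increasing card_mono) auto
    then show "real (divisor_count n) \<le> c ^ card P * real n powr \<epsilon>"
      using bound[OF \<open>n > 0\<close>] by (smt (verit) mult_right_mono powr_ge_zero)
  qed
qed

lemma harm_le_powr:
  fixes \<epsilon> :: real
  assumes "\<epsilon> > 0" "n > 0"
  shows "(harm n :: real) \<le> (1 + 1 / \<epsilon>) * real n powr \<epsilon>"
proof -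
  have "harm n - ln (real n) \<le> harm 1 - ln (real 1)"
    using assms by (intro euler_mascheroni_sequence_decreasing) auto
  then have "harm n \<le> 1 + ln (real n)" by (simp add: harm_def)
  also have "ln (real n) \<le> real n powr \<epsilon> / \<epsilon>"
    using assms by (intro ln_powr_bound) auto
  also have "1 \<le> real n powr \<epsilon>"
    using assms by (intro ge_one_powr_ge_zero) auto
  finally show ?thesis by (simp add: algebra_simps)
qed

lemma card_multiples:
  fixes d n :: nat
  shows "card {a \<in> {1..n}. d dvd a} = n div d"
proof (cases "d = 0")
  case False
  have "{a \<in> {1..n}. d dvd a} = (\<lambda>k. d * k) ` {1..n div d}"
  proof (intro equalityI subsetI)
    fix a assume "a \<in> {a \<in> {1..n}. d dvd a}"
    then obtain k where "a = d * k" "1 \<le> a" "a \<le> n" by auto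
    then show "a \<in> (\<lambda>k. d * k) ` {1..n div d}"
      using False by (auto simp: less_eq_div_iff_mult_less_eq mult.commute intro!: imageI)
  next
    fix a assume "a \<in> (\<lambda>k. d * k) ` {1..n div d}"
    then show "a \<in> {a \<in> {1..n}. d dvd a}"
      using False by (auto simp: less_eq_div_iff_mult_less_eq mult.commute)
  qed
  moreover have "inj_on (\<lambda>k. d * k) {1..n div d}" using False by (auto simp: inj_on_def)
  ultimately show ?thesis by (simp add: card_image)
qed auto

text \<open>The gcd is itself one of the divisors of \<open>m\<close> that divide \<open>a\<close>,
  so it is at most the sum of all of them. After interchanging sums, each \<open>d\<close>
  contributes \<open>d * (n div d) \<le> n\<close>.\<close>

lemma sum_gcd_le:
  assumes "m > 0"
  shows "(\<Sum>a = 1..n. gcd a m) \<le> n * divisor_count m"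
proof -
  have fin: "finite {d. d dvd m}" using assms by simp
  have "(\<Sum>a = 1..n. gcd a m) \<le> (\<Sum>a = 1..n. \<Sum>d | d dvd m. if d dvd a then d else 0)"
  proof (rule sum_mono)
    fix a
    have "gcd a m = (if gcd a m dvd a then gcd a m else 0)" by simp
    also have "\<dots> \<le> (\<Sum>d | d dvd m. if d dvd a then d else 0)"
      using fin by (intro member_le_sum) auto
    finally show "gcd a m \<le> \<dots>" .
  qed
  also have "\<dots> = (\<Sum>d | d dvd m. \<Sum>a = 1..n. if d dvd a then d else 0)"
    by (rule sum.swap)
  also have "\<dots> \<le> (\<Sum>d | d dvd m. n)"
  proof (rule sum_mono)
    fix d assume "d \<in> {d. d dvd m}"
    then show "(\<Sum>a = 1..n. if d dvd a then d else 0) \<le> n"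
      using card_multiples[of n d] div_times_less_eq_dividend[of n d]
      by (simp add: sum.If_cases Int_def)
  qed
  finally show ?thesis by (simp add: divisor_count_def mult.commute)
qed

subsection \<open>Products in residue classes\<close>

text \<open>A member of the class is determined by its quotient \<open>k = n div q < A\<close>. The
  term with \<open>k = 0\<close> is bounded by \<open>B\<close>, and the others by
  \<open>A / k\<close>, since \<open>n \<ge> k * q\<close>; these add up to a harmonic sum.\<close>

lemma sum_min_over_class_le:
  fixes A B q m :: nat
  assumes "q > 0"
  shows "(\<Sum>n | n \<in> {1..<A * q} \<and> [n = m] (mod q). min (real B) (real (q * A) / real n))
           \<le> real B + real A * harm A"
proof -
  define g where "g k = (if k = 0 then real B else real A / real k)" for k :: nat
  have g_nonneg: "g k \<ge> 0" for k by (simp add: g_def)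
  have "(\<Sum>n | n \<in> {1..<A * q} \<and> [n = m] (mod q). min (real B) (real (q * A) / real n))
      \<le> (\<Sum>k\<le>A. g k)"
  proof (rule sum_le_included[where i = "\<lambda>k. k * q + m mod q"])
    show "\<forall>n\<in>{n. n \<in> {1..<A * q} \<and> [n = m] (mod q)}. \<exists>k\<in>{..A}.
        k * q + m mod q = n \<and> min (real B) (real (q * A) / real n) \<le> g k"
    proof
      fix n assume n: "n \<in> {n. n \<in> {1..<A * q} \<and> [n = m] (mod q)}"
      have "n div q < A" using n assms by (simp add: less_mult_imp_div_less)
      moreover have "n div q * q + m mod q = n"
        using n by (metis (mono_tags, lifting) mem_Collect_eq cong_def div_mult_mod_eq)
      moreover have "min (real B) (real (q * A) / real n) \<le> g (n div q)"
      proof (cases "n div q = 0")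
        case False
        have "real (n div q) * real q \<le> real n"
          by (metis div_times_less_eq_dividend of_nat_le_iff of_nat_mult)
        moreover have "real n > 0" "real (n div q) > 0" using False n by auto
        moreover from calculation have "real (n div q) * real q * real A \<le> real n * real A"
          by (intro mult_right_mono) auto
        ultimately have "real (q * A) / real n \<le> real A / real (n div q)"
          by (simp add: divide_simps mult_ac)
        then show ?thesis using False by (simp add: g_def)
      qed (simp add: g_def)
      ultimately show "\<exists>k\<in>{..A}. k * q + m mod q = n \<and> min (real B) (real (q * A) / real n) \<le> g k"
        by (intro bexI[of _ "n div q"]) auto
    qed
  qed (use g_nonneg in auto)
  also have "{..A} = insert 0 {1..A}" by auto
  also have "(\<Sum>k\<in>insert 0 {1..A}. g k) = real B + (\<Sum>k = 1..A. g k)"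
    by (simp add: g_def)
  also have "(\<Sum>k = 1..A. g k) = real A * harm A"
    unfolding harm_def sum_distrib_left by (intro sum.cong) (auto simp: g_def field_simps)
  finally show ?thesis .
qed

text \<open>Pairs are grouped by the product \<open>n = a * v\<close>. It lies in the class of
  \<open>m\<close> below \<open>A * q\<close>, arises from at most \<open>D\<close> pairs since
  \<open>a\<close> divides \<open>n\<close> and fixes \<open>v\<close>, and \<open>a \<le> A\<close>
  gives \<open>q / v \<le> q * A / n\<close>.\<close>

lemma sum_min_hyperbola_le:
  fixes A B q m :: nat and D :: real
  assumes "q > 0" "A > 0"
    and D: "\<And>n. n > 0 \<Longrightarrow> n \<le> A * q \<Longrightarrow> real (divisor_count n) \<le> D"
  shows "(\<Sum>(a, v) | (a, v) \<in> {1..A} \<times> {1..<q} \<and> [a * v = m] (mod q). min (real B) (real q / real v))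
           \<le> D * (real B + real A * harm A)"
proof -
  define S where "S = {(a, v). (a, v) \<in> {1..A} \<times> {1..<q} \<and> [a * v = m] (mod q)}"
  define Y where "Y = {n. n \<in> {1..<A * q} \<and> [n = m] (mod q)}"
  define w where "w n = min (real B) (real (q * A) / real n)" for n :: nat
  have "S \<subseteq> {1..A} \<times> {1..<q}" by (auto simp: S_def)
  then have finS: "finite S" using finite_subset by blast
  have finY: "finite Y" by (simp add: Y_def)
  have img: "(\<lambda>(a, v). a * v) ` S \<subseteq> Y"
  proof -
    have "a * v < A * q" if "a \<le> A" "v < q" "1 \<le> a" for a v
      using that by (meson le_less_trans mult_le_mono1 mult_less_mono2 le_trans less_le_trans zero_less_one)
    then show ?thesis by (auto simp: S_def Y_def)
  qed
  have "(\<Sum>(a, v)\<in>S. min (real B) (real q / real v)) \<le> (\<Sum>p\<in>S. w (case p of (a, v) \<Rightarrow> a * v))"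
  proof (rule sum_mono, clarify)
    fix a v assume "(a, v) \<in> S"
    then have av: "1 \<le> a" "a \<le> A" "1 \<le> v" by (auto simp: S_def)
    then have "real q * real a \<le> real q * real A" by (intro mult_left_mono) auto
    then have "real q / real v \<le> real (q * A) / real (a * v)"
      using av by (simp add: divide_simps mult_ac)
    then show "min (real B) (real q / real v) \<le> w (a * v)" by (auto simp: w_def)
  qed
  also have "\<dots> = (\<Sum>n\<in>Y. \<Sum>p\<in>{p \<in> S. (case p of (a, v) \<Rightarrow> a * v) = n}. w (case p of (a, v) \<Rightarrow> a * v))"
    by (rule sum.group[symmetric, OF finS finY img])
  also have "\<dots> = (\<Sum>n\<in>Y. real (card {p \<in> S. (case p of (a, v) \<Rightarrow> a * v) = n}) * w n)"
    by (intro sum.cong refl) simp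
  also have "\<dots> \<le> (\<Sum>n\<in>Y. D * w n)"
  proof (intro sum_mono mult_right_mono)
    fix n assume "n \<in> Y"
    then have n: "n > 0" "n \<le> A * q" by (auto simp: Y_def)
    show "w n \<ge> 0" by (simp add: w_def)
    have "card {p \<in> S. (case p of (a, v) \<Rightarrow> a * v) = n} \<le> card {d. d dvd n}"
    proof (rule card_inj_on_le[where f = fst])
      show "inj_on fst {p \<in> S. (case p of (a, v) \<Rightarrow> a * v) = n}"
        using n by (auto simp: inj_on_def)
    qed (use n in auto)
    also have "\<dots> = divisor_count n" by (simp add: divisor_count_def)
    finally show "real (card {p \<in> S. (case p of (a, v) \<Rightarrow> a * v) = n}) \<le> D"
      using D[OF n] by linarith
  qed
  also have "\<dots> = D * (\<Sum>n\<in>Y. w n)" by (rule sum_distrib_left[symmetric])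
  also have "\<dots> \<le> D * (real B + real A * harm A)"
  proof (rule mult_left_mono)
    have "real (divisor_count 1) \<le> D" using assms(1,2) by (intro D) auto
    then show "D \<ge> 0" by linarith
  qed (use sum_min_over_class_le[OF assms(1), where A = A and B = B and m = m] in \<open>simp add: w_def Y_def\<close>)
  finally show ?thesis by (simp add: S_def)
qed

text \<open>With \<open>g = gcd (gcd a a') q\<close>, taking greatest common divisors shows that
  \<open>q\<close> divides \<open>(h - h') * g\<close> for any two solutions, so they agree modulo
  \<open>s = q / g\<close>. Each of the \<open>g\<close> blocks of length \<open>s\<close> in
  \<open>{..<q}\<close> thus holds at most one.\<close>

lemma card_simultaneous_congruence_le:
  fixes a a' q u v :: nat
  assumes "q > 0"
  shows "card {h \<in> {..<q}. h * a mod q = u \<and> h * a' mod q = v} \<le> gcd (gcd a a') q"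
proof -
  define H where "H = {h \<in> {..<q}. h * a mod q = u \<and> h * a' mod q = v}"
  define g where "g = gcd (gcd a a') q"
  have "g > 0" using assms by (simp add: g_def)
  obtain s where s: "q = g * s" using g_def by (metis gcd_dvd2 dvdE)
  have "h div s = h' div s \<longrightarrow> h = h'" if "h \<in> H" "h' \<in> H" for h h'
  proof
    assume eq: "h div s = h' div s"
    have "[h * a = h' * a] (mod q)" "[h * a' = h' * a'] (mod q)"
      using that by (auto simp: H_def cong_def)
    then have "int q dvd (int h - int h') * int a" "int q dvd (int h - int h') * int a'"
      by (auto simp: cong_iff_dvd_diff left_diff_distrib simp flip: cong_int_iff)
    then have "int q dvd gcd ((int h - int h') * int a) ((int h - int h') * int a')"
      by simp
    then have "int q dvd (int h - int h') * gcd (int a) (int a')"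
      by (metis gcd_mult_distrib_int dvd_abs_iff abs_mult abs_gcd_int gcd_abs1_int)
    then have "int q dvd gcd ((int h - int h') * gcd (int a) (int a')) ((int h - int h') * int q)"
      by simp
    then have "int q dvd (int h - int h') * int g"
      by (metis gcd_mult_distrib_int dvd_abs_iff abs_mult abs_of_nat g_def gcd_int_int_eq)
    then have "int s dvd int h - int h'"
      using \<open>g > 0\<close> s by (metis dvd_mult_cancel_right mult.commute of_nat_0_eq_iff of_nat_mult not_gr_zero)
    then have "h mod s = h' mod s"
      by (metis cong_iff_dvd_diff cong_int_iff cong_def)
    then show "h = h'" using eq by (metis div_mult_mod_eq)
  qed
  then have "inj_on (\<lambda>h. h div s) H" by (auto simp: inj_on_def)
  moreover have "(\<lambda>h. h div s) ` H \<subseteq> {..<g}"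
    using s by (auto simp: H_def less_mult_imp_div_less mult.commute)
  ultimately have "card H \<le> card {..<g}" by (intro card_inj_on_le) auto
  then show ?thesis by (simp add: H_def g_def)
qed

text \<open>If a solution exists, \<open>gcd (gcd a a') q\<close> divides \<open>u\<close>, being a
  divisor of both \<open>h * a\<close> and \<open>q\<close>. The resulting bound is free of
  \<open>a\<close> and \<open>v\<close>, so that in the mean square these can be summed
  first.\<close>

lemma card_simultaneous_congruence_le_gcd:
  fixes a a' q u v :: nat
  assumes "q > 0" "u > 0"
  shows "card {h \<in> {..<q}. h * a mod q = u \<and> h * a' mod q = v} \<le> gcd a' u"
proof (cases "{h \<in> {..<q}. h * a mod q = u \<and> h * a' mod q = v} = {}")
  case False
  then obtain h where "h * a mod q = u" by blast
  then have "gcd (gcd a a') q dvd u"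
    by (metis dvd_mod dvd_mult gcd_dvd1 gcd_dvd2 dvd_trans)
  then have "gcd (gcd a a') q dvd gcd a' u" by (metis gcd_dvd1 gcd_dvd2 dvd_trans gcd_greatest)
  then have "gcd (gcd a a') q \<le> gcd a' u" using assms by (intro dvd_imp_le) auto
  then show ?thesis using card_simultaneous_congruence_le[OF assms(1)] le_trans by blast
next
  case True
  then show ?thesis by (simp only: card.empty)
qed

text \<open>Opening the square yields triples \<open>(h, a, a')\<close>, recoded as
  \<open>(a', u, a, v)\<close> with \<open>u\<close> and \<open>v\<close> the residues of
  \<open>h * a\<close> and \<open>h * a'\<close>. Both \<open>a * v\<close> and
  \<open>a' * u\<close> are congruent to \<open>h * a * a'\<close>, and at most
  \<open>gcd a' u\<close> values of \<open>h\<close> share a code. The sum is taken over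
  \<open>(a, v)\<close> first, then over \<open>a'\<close>, then over \<open>u\<close>.\<close>

lemma sum_weighted_residues_square_le:
  fixes A B q :: nat and D :: real
  assumes "q > 0" "A > 0"
    and D: "\<And>n. n > 0 \<Longrightarrow> n \<le> A * q \<Longrightarrow> real (divisor_count n) \<le> D"
  defines "w \<equiv> \<lambda>u. min (real B) (real q / real u)"
  shows "(\<Sum>h<q. (\<Sum>a = 1..A. w (h * a mod q))\<^sup>2)
           \<le> D\<^sup>2 * real A * real q * harm q * (real B + real A * harm A)"
proof -
  define X where "X = D * (real B + real A * harm A)"
  have "real (divisor_count 1) \<le> D" using assms(1,2) by (intro D) auto
  then have "D \<ge> 0" by linarith
  have harm_nonneg: "harm n \<ge> (0::real)" for n by (simp add: harm_nonneg)
  have "X \<ge> 0" using \<open>D \<ge> 0\<close> harm_nonneg by (simp add: X_def)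
  \<comment> \<open>Division by zero yields zero, so the terms with \<open>q dvd h * a\<close> drop
    out here. This matches the frequencies that subtracting the expected count removes.\<close>
  have w0: "w 0 = 0" by (simp add: w_def)
  have w_nonneg: "w u \<ge> 0" for u by (simp add: w_def)
  define P where "P = {(h, a, a'). h < q \<and> a \<in> {1..A} \<and> a' \<in> {1..A} \<and> h * a mod q \<noteq> 0 \<and> h * a' mod q \<noteq> 0}"
  define Y where "Y = (SIGMA (a', u) : {1..A} \<times> {1..<q}.
      {(a, v). (a, v) \<in> {1..A} \<times> {1..<q} \<and> [a * v = a' * u] (mod q)})"
  define \<phi> where "\<phi> = (\<lambda>(h, a, a'). ((a', h * a mod q), (a, h * a' mod q)))"
  define f where "f = (\<lambda>((a'::nat, u), (a::nat, v)). w u * w v)"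
  have finsub: "finite {(a, v). (a, v) \<in> {1..A} \<times> {1..<q} \<and> [a * v = m] (mod q)}" for m
    by (rule finite_subset[of _ "{1..A} \<times> {1..<q}"]) auto
  have finY: "finite Y" unfolding Y_def by (intro finite_SigmaI) (use finsub in auto)
  have "P \<subseteq> {..<q} \<times> {1..A} \<times> {1..A}" by (auto simp: P_def)
  then have finP: "finite P" using finite_subset by blast
  have img: "\<phi> ` P \<subseteq> Y"
  proof
    fix y assume "y \<in> \<phi> ` P"
    then obtain h a a' where y: "y = ((a', h * a mod q), (a, h * a' mod q))"
      and "h < q" "a \<in> {1..A}" "a' \<in> {1..A}" "h * a mod q \<noteq> 0" "h * a' mod q \<noteq> 0"
      by (auto simp: \<phi>_def P_def)
    moreover have "[a * (h * a' mod q) = a' * (h * a mod q)] (mod q)"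
      by (simp add: cong_def mod_mult_right_eq mult_ac)
    ultimately show "y \<in> Y" using assms(1) by (auto simp: Y_def)
  qed
  have "(\<Sum>h<q. (\<Sum>a = 1..A. w (h * a mod q))\<^sup>2)
      = (\<Sum>(h, a, a')\<in>{..<q} \<times> {1..A} \<times> {1..A}. w (h * a mod q) * w (h * a' mod q))"
    by (simp add: power2_eq_square sum_product sum.cartesian_product)
  also have "\<dots> = (\<Sum>(h, a, a')\<in>P. w (h * a mod q) * w (h * a' mod q))"
    by (rule sum.mono_neutral_right) (auto simp: P_def, (metis w0 gr0I)+)
  also have "\<dots> = (\<Sum>p\<in>P. f (\<phi> p))"
    by (intro sum.cong) (auto simp: f_def \<phi>_def)
  also have "\<dots> = (\<Sum>y\<in>Y. \<Sum>p\<in>{p \<in> P. \<phi> p = y}. f (\<phi> p))"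
    by (rule sum.group[symmetric, OF finP finY img])
  also have "\<dots> = (\<Sum>y\<in>Y. real (card {p \<in> P. \<phi> p = y}) * f y)"
    by (intro sum.cong refl) simp
  also have "\<dots> \<le> (\<Sum>((a', u), (a, v))\<in>Y. real (gcd a' u) * (w u * w v))"
  proof (rule sum_mono, clarify)
    fix a' u a v assume y: "((a', u), (a, v)) \<in> Y"
    then have "u > 0" by (auto simp: Y_def)
    have "card {p \<in> P. \<phi> p = ((a', u), (a, v))}
        \<le> card {h \<in> {..<q}. h * a mod q = u \<and> h * a' mod q = v}"
      by (rule card_inj_on_le[where f = fst]) (auto simp: inj_on_def P_def \<phi>_def)
    also have "\<dots> \<le> gcd a' u" by (rule card_simultaneous_congruence_le_gcd[OF assms(1) \<open>u > 0\<close>])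
    finally show "real (card {p \<in> P. \<phi> p = ((a', u), (a, v))}) * f ((a', u), (a, v))
        \<le> real (gcd a' u) * (w u * w v)"
      by (auto simp: f_def w_nonneg intro!: mult_right_mono)
  qed
  also have "\<dots> = (\<Sum>(a', u)\<in>{1..A} \<times> {1..<q}. \<Sum>(a, v) |
      (a, v) \<in> {1..A} \<times> {1..<q} \<and> [a * v = a' * u] (mod q). real (gcd a' u) * (w u * w v))"
    unfolding Y_def by (subst sum.Sigma[symmetric]) (use finsub in \<open>auto simp: case_prod_unfold\<close>)
  also have "\<dots> = (\<Sum>(a', u)\<in>{1..A} \<times> {1..<q}. real (gcd a' u) * w u * (\<Sum>(a, v) |
      (a, v) \<in> {1..A} \<times> {1..<q} \<and> [a * v = a' * u] (mod q). w v))"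
    by (simp add: sum_distrib_left case_prod_unfold mult.assoc)
  \<comment> \<open>For fixed \<open>(a', u)\<close> the inner sum falls under the hyperbola bound
    \<open>X\<close>; the other weight \<open>w u\<close> is relaxed to \<open>q / u\<close>,
    leaving a gcd sum over \<open>a'\<close> and a harmonic sum over \<open>u\<close>.\<close>
  also have "\<dots> \<le> (\<Sum>(a', u)\<in>{1..A} \<times> {1..<q}. real (gcd a' u) * (real q / real u) * X)"
  proof (rule sum_mono, clarify)
    fix a' u
    show "real (gcd a' u) * w u * (\<Sum>(a, v) | (a, v) \<in> {1..A} \<times> {1..<q} \<and>
        [a * v = a' * u] (mod q). w v) \<le> real (gcd a' u) * (real q / real u) * X"
      using sum_min_hyperbola_le[OF assms(1,2) D, where m = "a' * u" and B = B] \<open>X \<ge> 0\<close> w_nonneg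
      by (intro mult_mono) (auto simp: X_def w_def intro!: sum_nonneg)
  qed
  also have "\<dots> = (\<Sum>u = 1..<q. \<Sum>a' = 1..A. real (gcd a' u) * (real q / real u) * X)"
    by (subst sum.cartesian_product[symmetric]) (rule sum.swap)
  also have "\<dots> = (\<Sum>u = 1..<q. real (\<Sum>a' = 1..A. gcd a' u) * (real q / real u) * X)"
    by (simp add: sum_distrib_right sum_divide_distrib)
  also have "\<dots> \<le> (\<Sum>u = 1..<q. (real A * D) * (real q / real u) * X)"
  proof (intro sum_mono mult_right_mono)
    fix u assume u: "u \<in> {1..<q}"
    have "u \<le> A * q" using u assms(2) by (metis atLeastLessThan_iff less_imp_le mult_le_mono Suc_leI One_nat_def nat_mult_1)
    then have "real (divisor_count u) \<le> D" using D u by auto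
    moreover have "real (\<Sum>a' = 1..A. gcd a' u) \<le> real A * real (divisor_count u)"
      using sum_gcd_le[of u A] u by (metis of_nat_le_iff of_nat_mult atLeastLessThan_iff zero_less_one less_le_trans)
    ultimately show "real (\<Sum>a' = 1..A. gcd a' u) \<le> real A * D"
      by (meson mult_left_mono of_nat_0_le_iff order_trans)
  qed (use \<open>X \<ge> 0\<close> in auto)
  also have "\<dots> = real A * D * real q * X * (\<Sum>u = 1..<q. 1 / real u)"
    by (simp add: sum_distrib_left mult_ac)
  also have "\<dots> \<le> real A * D * real q * X * harm q"
  proof (rule mult_left_mono)
    show "(\<Sum>u = 1..<q. 1 / real u) \<le> harm q"
      unfolding harm_def by (simp add: inverse_eq_divide) (rule sum_mono2, auto)
  qed (use \<open>X \<ge> 0\<close> \<open>D \<ge> 0\<close> in auto)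
  also have "\<dots> = D\<^sup>2 * real A * real q * harm q * (real B + real A * harm A)"
    by (simp add: X_def power2_eq_square)
  finally show ?thesis .
qed

subsection \<open>Finite Fourier analysis\<close>

text \<open>The additive character \<open>exp (2 * pi * \<i> * k / q)\<close>; later
  \<open>k\<close> is a frequency times a residue.\<close>

definition root_of_unity_power :: "nat \<Rightarrow> nat \<Rightarrow> complex" where
  "root_of_unity_power q k = cis (2 * pi * real k / real q)"

lemma norm_root_of_unity_power [simp]: "norm (root_of_unity_power q k) = 1"
  by (simp add: root_of_unity_power_def)

lemma root_of_unity_power_eq_1_iff:
  assumes "q > 0"
  shows "root_of_unity_power q k = 1 \<longleftrightarrow> q dvd k"
proof
  assume "root_of_unity_power q k = 1"
  then have "cos (2 * pi * real k / real q) = 1"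
    by (simp add: root_of_unity_power_def complex_eq_iff)
  then obtain n :: int where "2 * pi * real k / real q = of_int n * (2 * pi)"
    using cos_one_2pi_int by (metis mult.commute mult.left_commute)
  then have "real k = of_int n * real q"
    using assms by (simp add: field_simps)
  then have "int k = n * int q"
    by (metis of_int_eq_iff of_int_mult of_int_of_nat_eq)
  then show "q dvd k" by (metis dvd_triv_right int_dvd_int_iff)
next
  assume "q dvd k"
  then obtain j where "k = q * j" by blast
  then have "2 * pi * real k / real q = 2 * pi * real j" using assms by simp
  then show "root_of_unity_power q k = 1"
    unfolding root_of_unity_power_def by (metis cis_multiple_2pi Ints_of_nat)
qed

lemma root_of_unity_power_add:
  "root_of_unity_power q (j + k) = root_of_unity_power q j * root_of_unity_power q k"
  by (simp add: root_of_unity_power_def cis_mult add_divide_distrib distrib_left)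

lemma root_of_unity_power_mult:
  "root_of_unity_power q (j * k) = root_of_unity_power q j ^ k"
  unfolding root_of_unity_power_def Complex.DeMoivre by (simp add: mult_ac)

lemma root_of_unity_power_mod [simp]:
  assumes "q > 0"
  shows "root_of_unity_power q (k mod q) = root_of_unity_power q k"
proof -
  have "root_of_unity_power q k = root_of_unity_power q (k div q * q + k mod q)" by simp
  also have "\<dots> = root_of_unity_power q (k mod q)"
    unfolding root_of_unity_power_add using root_of_unity_power_eq_1_iff[OF assms] by simp
  finally show ?thesis by simp
qed

lemma root_of_unity_power_eq_iff:
  assumes "q > 0" "x < q" "y < q"
  shows "root_of_unity_power q x = root_of_unity_power q y \<longleftrightarrow> x = y"
proof -
  have "y \<le> x \<Longrightarrow> root_of_unity_power q x = root_of_unity_power q y \<Longrightarrow> x < q \<Longrightarrow> x = y" for x y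
  proof -
    assume *: "y \<le> x" "root_of_unity_power q x = root_of_unity_power q y" "x < q"
    have "root_of_unity_power q x = root_of_unity_power q (x - y) * root_of_unity_power q y"
      using root_of_unity_power_add[of q "x - y" y] * by simp
    moreover have "root_of_unity_power q y \<noteq> 0"
      using norm_root_of_unity_power[of q y] by force
    ultimately have "root_of_unity_power q (x - y) = 1" using * by simp
    then have "q dvd x - y" using root_of_unity_power_eq_1_iff[OF assms(1)] by simp
    then show "x = y" using * by (metis diff_is_0_eq dvd_imp_le le_antisym less_imp_diff_less not_gr_zero not_less)
  qed
  then show ?thesis using assms by (metis nat_le_linear)
qed

lemma sum_powers_eq_0:
  fixes z :: "'a :: field"
  assumes "z \<noteq> 1" "z ^ n = 1"
  shows "(\<Sum>k<n. z ^ k) = 0"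
  using assms by (simp add: geometric_sum)

text \<open>Expanding the squared norm and summing over \<open>h\<close> first leaves the diagonal
  \<open>x = y\<close>. The transform carries no normalisation, hence the factor
  \<open>q\<close>.\<close>

lemma parseval_mod:
  fixes f :: "nat \<Rightarrow> real"
  assumes "q > 0"
  shows "(\<Sum>h<q. (norm (\<Sum>x<q. complex_of_real (f x) * root_of_unity_power q (h * x)))\<^sup>2)
           = real q * (\<Sum>x<q. (f x)\<^sup>2)"
proof -
  let ?e = "root_of_unity_power q"
  have orth: "(\<Sum>h<q. ?e (h * x) * cnj (?e (h * y))) = (if x = y then of_nat q else 0)"
    if "x < q" "y < q" for x y
  proof -
    \<comment> \<open>The character value at \<open>x - y\<close>: a \<open>q\<close>-th root of
      unity, different from \<open>1\<close> unless \<open>x = y\<close>, so that its powers sum to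
      zero off the diagonal.\<close>
    define z where "z = ?e x * cnj (?e y)"
    have unit: "?e k * cnj (?e k) = 1" for k
      using complex_norm_square[of "?e k"] by simp
    have "(\<Sum>h<q. ?e (h * x) * cnj (?e (h * y))) = (\<Sum>h<q. z ^ h)"
      by (intro sum.cong refl)
        (simp add: z_def mult.commute[of _ x] mult.commute[of _ y] root_of_unity_power_mult power_mult_distrib)
    moreover have "(\<Sum>h<q. z ^ h) = 0" if "x \<noteq> y"
    proof (rule sum_powers_eq_0)
      show "z \<noteq> 1"
      proof
        assume "z = 1"
        then have "?e x * (?e y * cnj (?e y)) = ?e y" by (simp add: z_def mult_ac)
        then have "?e x = ?e y" using unit by simp
        then show False using root_of_unity_power_eq_iff \<open>x < q\<close> \<open>y < q\<close> assms \<open>x \<noteq> y\<close> by blast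
      qed
      have "?e k ^ q = 1" for k
        using root_of_unity_power_eq_1_iff[OF assms, of "k * q"] by (simp add: root_of_unity_power_mult)
      then show "z ^ q = 1" by (simp add: z_def power_mult_distrib flip: complex_cnj_power)
    qed
    moreover have "(\<Sum>h<q. z ^ h) = of_nat q" if "x = y"
      using that unit by (simp add: z_def)
    ultimately show ?thesis by auto
  qed
  have "complex_of_real (\<Sum>h<q. (norm (\<Sum>x<q. complex_of_real (f x) * ?e (h * x)))\<^sup>2)
      = (\<Sum>h<q. (\<Sum>x<q. complex_of_real (f x) * ?e (h * x)) * cnj (\<Sum>x<q. complex_of_real (f x) * ?e (h * x)))"
    by (simp add: complex_norm_square del: cnj_sum of_real_power)
  also have "\<dots> = (\<Sum>h<q. \<Sum>x<q. \<Sum>y<q. of_real (f x) * of_real (f y) * (?e (h * x) * cnj (?e (h * y))))"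
    by (simp add: sum_product mult_ac)
  also have "\<dots> = (\<Sum>x<q. \<Sum>h<q. \<Sum>y<q. of_real (f x) * of_real (f y) * (?e (h * x) * cnj (?e (h * y))))"
    by (rule sum.swap)
  also have "\<dots> = (\<Sum>x<q. \<Sum>y<q. \<Sum>h<q. of_real (f x) * of_real (f y) * (?e (h * x) * cnj (?e (h * y))))"
    by (intro sum.cong refl sum.swap)
  also have "\<dots> = (\<Sum>x<q. \<Sum>y<q. of_real (f x) * of_real (f y) * (if x = y then of_nat q else 0))"
    by (intro sum.cong refl) (simp add: orth flip: sum_distrib_left)
  also have "\<dots> = (\<Sum>x<q. of_real (f x) * of_real (f x) * of_nat q)"
    by (intro sum.cong refl) (simp add: if_distrib cong: if_cong)
  also have "\<dots> = complex_of_real (real q * (\<Sum>x<q. (f x)\<^sup>2))"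
    by (simp add: sum_distrib_left power2_eq_square mult_ac)
  finally show ?thesis using of_real_eq_iff by blast
qed

section \<open>Bounds for geometric sums of roots of unity\<close>

lemma sin_ge_chord:
  assumes "0 \<le> t" "t \<le> 1"
  shows "sin (t * (pi / 2)) \<ge> t"
proof -
  \<comment> \<open>Jordan's inequality: sine is concave on \<open>{0..pi/2}\<close> and hence lies
    above the chord between the endpoints.\<close>
  have "convex_on {0..pi/2} (\<lambda>x. - sin x)"
    by (rule f''_ge0_imp_convex[where f' = "\<lambda>x. - cos x" and f'' = "\<lambda>x. sin x"])
      (auto intro!: derivative_eq_intros sin_ge_zero)
  then have "- sin ((1 - t) * 0 + t * (pi / 2)) \<le> (1 - t) * (- sin 0) + t * (- sin (pi / 2))"
    using assms convex_onD[of "{0..pi/2}" "\<lambda>x. - sin x" t 0 "pi/2"] by simp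
  then show ?thesis by simp
qed

text \<open>The norm equals \<open>2 * \<bar>sin (pi * u / q)\<bar>\<close>. For \<open>u\<close>
  above \<open>q / 2\<close> the reflection \<open>sin x = sin (pi - x)\<close> brings the angle
  back to the range of the chord bound.\<close>

lemma norm_one_minus_root_of_unity_power:
  assumes "u < q"
  shows "norm (1 - root_of_unity_power q u) \<ge> 4 * min (real u) (real q - real u) / real q"
proof -
  define x where "x = pi * real u / real q"
  have ident: "(1 - (1 - 2 * s ^ 2)) ^ 2 + (2 * s * c) ^ 2 = (2 * s) ^ 2 * (s ^ 2 + c ^ 2)"
    for s c :: real by (simp add: power2_eq_square algebra_simps)
  have "norm (1 - root_of_unity_power q u) ^ 2 = (1 - cos (2 * x)) ^ 2 + sin (2 * x) ^ 2"
    by (simp add: root_of_unity_power_def x_def cmod_def mult.assoc)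
  also have "\<dots> = (2 * sin x) ^ 2 * (sin x ^ 2 + cos x ^ 2)"
    unfolding cos_double_sin sin_double by (rule ident)
  also have "\<dots> = (2 * sin x) ^ 2" by simp
  finally have "norm (1 - root_of_unity_power q u) = \<bar>2 * sin x\<bar>"
    by (metis abs_norm_cancel power2_eq_iff abs_eq_iff)
  moreover have "sin x \<ge> 2 * min (real u) (real q - real u) / real q"
  proof (cases "2 * u \<le> q")
    case True
    have "sin x = sin ((2 * real u / real q) * (pi / 2))" by (simp add: x_def mult.commute)
    also have "\<dots> \<ge> 2 * real u / real q"
      using True assms by (intro sin_ge_chord) (auto simp: field_simps)
    finally show ?thesis
      by (smt (verit) divide_right_mono of_nat_0_le_iff)
  next
    case False
    have "sin x = sin (pi - x)" by simp
    also have "pi - x = (2 * (real q - real u) / real q) * (pi / 2)"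
      using assms by (simp add: x_def field_simps)
    also have "sin \<dots> \<ge> 2 * (real q - real u) / real q"
      using False assms by (intro sin_ge_chord) (auto simp: field_simps)
    finally show ?thesis
      by (smt (verit) divide_right_mono of_nat_0_le_iff)
  qed
  ultimately show ?thesis by (simp add: field_simps)
qed

text \<open>Besides the trivial bound \<open>B\<close>, multiplying by \<open>1 - z\<close> leaves a
  quantity of norm at most \<open>2\<close>. The minimum of \<open>u\<close> and
  \<open>q - u\<close> is replaced by a sum of two weights so that each depends on one residue only:
  that of \<open>h * a\<close>, or that of \<open>(q - h) * a\<close>.\<close>

lemma norm_geometric_sum_le:
  assumes "0 < u" "u < q"
  shows "norm (\<Sum>b = 1..B. root_of_unity_power q u ^ b)
           \<le> min (real B) (real q / real u) + min (real B) (real q / real (q - u))"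
proof -
  define z where "z = root_of_unity_power q u"
  define \<mu> where "\<mu> = min (real u) (real q - real u)"
  have "norm z = 1" by (simp add: z_def)
  have "z \<noteq> 1"
    using root_of_unity_power_eq_1_iff[of q u] assms by (auto simp: z_def dest: dvd_imp_le)
  have "norm (\<Sum>b = 1..B. z ^ b) \<le> (\<Sum>b = 1..B. norm (z ^ b))" by (rule norm_sum)
  then have le_B: "norm (\<Sum>b = 1..B. z ^ b) \<le> real B"
    using \<open>norm z = 1\<close> by (simp add: norm_power)
  have "(\<Sum>b = 1..B. z ^ b) = (\<Sum>k<B. z ^ Suc k)"
    by (rule sum.reindex_bij_witness[of _ Suc "\<lambda>b. b - 1"]) auto
  also have "\<dots> = z * (\<Sum>k<B. z ^ k)" by (simp add: sum_distrib_left)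
  finally have "(1 - z) * (\<Sum>b = 1..B. z ^ b) = z * (1 - z ^ B)"
    by (simp add: one_diff_power_eq mult_ac)
  then have "norm (1 - z) * norm (\<Sum>b = 1..B. z ^ b) = norm (1 - z ^ B)"
    by (metis norm_mult \<open>norm z = 1\<close> mult_1)
  also have "\<dots> \<le> 2"
    using norm_triangle_ineq4[of 1 "z ^ B"] \<open>norm z = 1\<close> by (simp add: norm_power)
  finally have "norm (1 - z) * norm (\<Sum>b = 1..B. z ^ b) \<le> 2" .
  moreover have "\<mu> > 0" using assms by (auto simp: \<mu>_def)
  moreover have "norm (1 - z) \<ge> 4 * \<mu> / real q"
    using norm_one_minus_root_of_unity_power[OF assms(2)] by (simp add: z_def \<mu>_def)
  ultimately have "4 * \<mu> / real q * norm (\<Sum>b = 1..B. z ^ b) \<le> 2"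
    by (meson mult_right_mono norm_ge_zero order_trans)
  then have "norm (\<Sum>b = 1..B. z ^ b) \<le> real q / \<mu>"
    using \<open>\<mu> > 0\<close> assms by (simp add: field_simps)
  with le_B have "norm (\<Sum>b = 1..B. z ^ b) \<le> min (real B) (real q / \<mu>)" by simp
  also have "\<dots> \<le> min (real B) (real q / real u) + min (real B) (real q / real (q - u))"
    using assms by (auto simp: \<mu>_def min_def of_nat_diff)
  finally show ?thesis by (simp add: z_def)
qed

subsection \<open>Mean square of the discrepancy\<close>

definition product_residue_count :: "nat \<Rightarrow> nat \<Rightarrow> nat \<Rightarrow> nat \<Rightarrow> nat" where
  "product_residue_count A B q x = card {(a, b) \<in> {1..A} \<times> {1..B}. [a * b = x] (mod q)}"

text \<open>For fixed \<open>a\<close>, the congruence \<open>a * b = x\<close> confines \<open>b\<close> to one class modulo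
  \<open>q / gcd a q\<close>, or to none; this is the expected number of such \<open>b\<close>, summed over \<open>a\<close>.\<close>

definition expected_residue_count :: "nat \<Rightarrow> nat \<Rightarrow> nat \<Rightarrow> nat \<Rightarrow> real" where
  "expected_residue_count A B q x =
     real B / real q * (\<Sum>a = 1..A. if gcd a q dvd x then real (gcd a q) else 0)"

abbreviation residue_discrepancy :: "nat \<Rightarrow> nat \<Rightarrow> nat \<Rightarrow> nat \<Rightarrow> real" where
  "residue_discrepancy A B q x \<equiv>
     real (product_residue_count A B q x) - expected_residue_count A B q x"

lemma product_residue_count_cong:
  assumes "[x = y] (mod q)"
  shows "product_residue_count A B q x = product_residue_count A B q y"
proof -
  have "[a * b = x] (mod q) \<longleftrightarrow> [a * b = y] (mod q)" for a b
    using assms by (auto simp: cong_def)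
  then show ?thesis by (simp add: product_residue_count_def)
qed

lemma residue_discrepancy_mod:
  "residue_discrepancy A B q (x mod q) = residue_discrepancy A B q x"
proof -
  have "product_residue_count A B q (x mod q) = product_residue_count A B q x"
    by (rule product_residue_count_cong) simp
  moreover have "gcd a q dvd x mod q \<longleftrightarrow> gcd a q dvd x" for a
    by (simp add: dvd_mod_iff)
  ultimately show ?thesis by (simp add: expected_residue_count_def)
qed

text \<open>The multiples of \<open>g\<close> below \<open>q\<close> are \<open>g * y\<close> with
  \<open>y < q / g\<close>, so the sum is geometric with ratio \<open>z\<close>. Since
  \<open>z\<close> to the power \<open>q / g\<close> is the character at \<open>h * q\<close>, that
  is \<open>1\<close>, it vanishes unless \<open>z = 1\<close>.\<close>

lemma sum_multiples_root_of_unity_power: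
  assumes "q > 0" "g dvd q"
  shows "(\<Sum>x<q. if g dvd x then root_of_unity_power q (h * x) else 0)
           = (if q dvd h * g then of_nat q / of_nat g else 0)"
proof -
  obtain s where s: "q = g * s" using assms by blast
  have "g > 0" "s > 0" using s assms by auto
  define z where "z = root_of_unity_power q (h * g)"
  have "(\<Sum>x<q. if g dvd x then root_of_unity_power q (h * x) else 0)
      = (\<Sum>x | x < q \<and> g dvd x. root_of_unity_power q (h * x))"
    by (simp add: sum.If_cases Int_def conj_commute)
  also have "\<dots> = (\<Sum>y<s. root_of_unity_power q (h * (g * y)))"
    by (rule sum.reindex_bij_witness[of _ "\<lambda>y. g * y" "\<lambda>x. x div g"])
      (use \<open>g > 0\<close> s in \<open>auto simp: less_mult_imp_div_less mult.commute elim!: dvdE\<close>)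
  also have "\<dots> = (\<Sum>y<s. z ^ y)"
    by (simp add: z_def root_of_unity_power_mult[symmetric] mult.assoc)
  also have "\<dots> = (if q dvd h * g then of_nat s else 0)"
  proof (cases "q dvd h * g")
    case True
    then have "z = 1" using root_of_unity_power_eq_1_iff[OF assms(1)] by (simp add: z_def)
    then show ?thesis using True by simp
  next
    case False
    then have "z \<noteq> 1" using root_of_unity_power_eq_1_iff[OF assms(1)] by (simp add: z_def)
    moreover have "z ^ s = root_of_unity_power q (h * q)"
      by (simp add: z_def s mult.assoc root_of_unity_power_mult[symmetric])
    then have "z ^ s = 1" using root_of_unity_power_eq_1_iff[OF assms(1)] by simp
    ultimately show ?thesis using False sum_powers_eq_0 by simp
  qed
  also have "of_nat s = (of_nat q / of_nat g :: complex)"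
    using s \<open>g > 0\<close> by simp
  finally show ?thesis .
qed

lemma fourier_product_residue_count:
  assumes "q > 0"
  shows "(\<Sum>x<q. of_nat (product_residue_count A B q x) * root_of_unity_power q (h * x))
           = (\<Sum>a = 1..A. \<Sum>b = 1..B. root_of_unity_power q (h * a) ^ b)"
proof -
  let ?S = "{1..A} \<times> {1..B}"
  have "(\<Sum>a = 1..A. \<Sum>b = 1..B. root_of_unity_power q (h * a) ^ b)
      = (\<Sum>p\<in>?S. root_of_unity_power q (h * (fst p * snd p)))"
    by (simp add: sum.cartesian_product case_prod_unfold root_of_unity_power_mult[symmetric] mult.assoc)
  also have "\<dots> = (\<Sum>x<q. \<Sum>p\<in>{p \<in> ?S. fst p * snd p mod q = x}. root_of_unity_power q (h * (fst p * snd p)))"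
    by (rule sum.group[symmetric]) (use assms in auto)
  also have "\<dots> = (\<Sum>x<q. of_nat (product_residue_count A B q x) * root_of_unity_power q (h * x))"
  proof (intro sum.cong refl)
    fix x assume x: "x \<in> {..<q}"
    have eq: "root_of_unity_power q (h * (fst p * snd p)) = root_of_unity_power q (h * x)"
      if "p \<in> {p \<in> ?S. fst p * snd p mod q = x}" for p
      using that root_of_unity_power_mod[OF assms] by (metis (mono_tags, lifting) mem_Collect_eq mod_mult_right_eq)
    have "{p \<in> ?S. fst p * snd p mod q = x} = {(a, b) \<in> ?S. [a * b = x] (mod q)}"
      using x by (auto simp: cong_def)
    then have "card {p \<in> ?S. fst p * snd p mod q = x} = product_residue_count A B q x"
      by (simp add: product_residue_count_def)
    then show "(\<Sum>p\<in>{p \<in> ?S. fst p * snd p mod q = x}. root_of_unity_power q (h * (fst p * snd p)))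
        = of_nat (product_residue_count A B q x) * root_of_unity_power q (h * x)"
      by (simp add: sum.cong[OF refl eq] del: mem_Collect_eq)
  qed
  finally show ?thesis ..
qed

lemma dvd_mult_gcd_iff:
  fixes a h q :: nat
  shows "q dvd h * gcd a q \<longleftrightarrow> q dvd h * a"
proof -
  have "q dvd h * gcd a q \<longleftrightarrow> q dvd gcd (h * a) (h * q)" by (simp add: gcd_mult_distrib_nat)
  then show ?thesis by simp
qed

text \<open>Each \<open>a\<close> contributes a multiple of the indicator of
  \<open>gcd a q dvd x\<close>, whose transform lives on the \<open>h\<close> with
  \<open>q dvd h * a\<close>; there the factors \<open>gcd a q\<close> and \<open>q\<close> cancel
  to leave \<open>B\<close>.\<close>

lemma fourier_expected_residue_count:
  assumes "q > 0"
  shows "(\<Sum>x<q. of_real (expected_residue_count A B q x) * root_of_unity_power q (h * x))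
           = (\<Sum>a = 1..A. if q dvd h * a then of_nat B else 0)"
proof -
  have "(\<Sum>x<q. of_real (expected_residue_count A B q x) * root_of_unity_power q (h * x))
      = (\<Sum>x<q. \<Sum>a = 1..A. of_nat B / of_nat q * of_nat (gcd a q) *
            (if gcd a q dvd x then root_of_unity_power q (h * x) else 0))"
    by (intro sum.cong refl)
      (simp add: expected_residue_count_def sum_distrib_left sum_distrib_right if_distrib mult_ac cong: if_cong)
  also have "\<dots> = (\<Sum>a = 1..A. of_nat B / of_nat q * of_nat (gcd a q) *
            (\<Sum>x<q. if gcd a q dvd x then root_of_unity_power q (h * x) else 0))"
    by (subst sum.swap) (simp add: sum_distrib_left)
  also have "\<dots> = (\<Sum>a = 1..A. if q dvd h * a then of_nat B else 0)"
    using assms by (intro sum.cong refl) (simp add: sum_multiples_root_of_unity_power dvd_mult_gcd_iff)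
  finally show ?thesis .
qed

text \<open>If \<open>q dvd h * a\<close>, every power in the sum over \<open>b\<close> is
  \<open>1\<close> and the sum is \<open>B\<close>, exactly what the expected count subtracts. Only
  the geometric sums with ratio different from \<open>1\<close> remain, which is the reason for this
  choice of expected count.\<close>

lemma fourier_residue_discrepancy:
  assumes "q > 0"
  shows "(\<Sum>x<q. complex_of_real (residue_discrepancy A B q x) * root_of_unity_power q (h * x))
           = (\<Sum>a = 1..A. if q dvd h * a then 0 else \<Sum>b = 1..B. root_of_unity_power q (h * a) ^ b)"
proof -
  have "(\<Sum>x<q. complex_of_real (residue_discrepancy A B q x) * root_of_unity_power q (h * x))
      = (\<Sum>x<q. of_nat (product_residue_count A B q x) * root_of_unity_power q (h * x))
        - (\<Sum>x<q. of_real (expected_residue_count A B q x) * root_of_unity_power q (h * x))"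
    by (simp add: algebra_simps sum_subtractf)
  also have "\<dots> = (\<Sum>a = 1..A. (\<Sum>b = 1..B. root_of_unity_power q (h * a) ^ b)
      - (if q dvd h * a then of_nat B else 0))"
    by (simp add: fourier_product_residue_count fourier_expected_residue_count assms sum_subtractf)
  also have "\<dots> = (\<Sum>a = 1..A. if q dvd h * a then 0 else \<Sum>b = 1..B. root_of_unity_power q (h * a) ^ b)"
    by (intro sum.cong refl) (auto simp: root_of_unity_power_eq_1_iff[OF assms, THEN iffD2])
  finally show ?thesis .
qed

text \<open>Parseval turns the left side into the mean square of \<open>F\<close>, and the geometric
  sum bound gives \<open>S h + S (q - h)\<close>. The reflected part has no larger mean square than
  \<open>S\<close>, whence the factor \<open>4\<close>.\<close>

lemma sum_residue_discrepancy_square_le: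
  fixes A B q :: nat and D :: real
  assumes "q > 0" "A > 0"
    and D: "\<And>n. n > 0 \<Longrightarrow> n \<le> A * q \<Longrightarrow> real (divisor_count n) \<le> D"
  shows "(\<Sum>x<q. (residue_discrepancy A B q x)\<^sup>2)
           \<le> 4 * D\<^sup>2 * real A * harm q * (real B + real A * harm A)"
proof -
  define w where "w = (\<lambda>u. min (real B) (real q / real u))"
  define S where "S h = (\<Sum>a = 1..A. w (h * a mod q))" for h
  define F where "F h = (\<Sum>x<q. complex_of_real (residue_discrepancy A B q x) * root_of_unity_power q (h * x))" for h
  have w_nonneg: "w u \<ge> 0" for u by (simp add: w_def)
  have norm_F: "norm (F h) \<le> S h + S (q - h)" if "h < q" for h
  proof -
    have "norm (F h) \<le> (\<Sum>a = 1..A. norm (if q dvd h * a then 0 else \<Sum>b = 1..B. root_of_unity_power q (h * a) ^ b))"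
      unfolding F_def fourier_residue_discrepancy[OF assms(1)] by (rule norm_sum)
    also have "\<dots> \<le> (\<Sum>a = 1..A. w (h * a mod q) + w ((q - h) * a mod q))"
    proof (rule sum_mono)
      fix a
      show "norm (if q dvd h * a then 0 else \<Sum>b = 1..B. root_of_unity_power q (h * a) ^ b)
          \<le> w (h * a mod q) + w ((q - h) * a mod q)"
      proof (cases "q dvd h * a")
        case False
        define u where "u = h * a mod q"
        have u: "0 < u" "u < q" using False assms(1) by (auto simp: u_def dvd_eq_mod_eq_0)
        \<comment> \<open>The residues of \<open>h * a\<close> and \<open>(q - h) * a\<close> add up
          to a multiple of \<open>q\<close> strictly between \<open>0\<close> and
          \<open>2 * q\<close>, hence to \<open>q\<close>.\<close>
        have "((q - h) * a + h * a) mod q = 0"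
          using that by (simp flip: distrib_right)
        then have "((q - h) * a mod q + u) mod q = 0" by (simp add: u_def mod_add_eq)
        moreover have "0 < (q - h) * a mod q + u" "(q - h) * a mod q + u < 2 * q"
          using u mod_less_divisor[OF assms(1), of "(q - h) * a"] by linarith+
        ultimately have "(q - h) * a mod q + u = q"
          by (auto elim!: dvdE simp: dvd_eq_mod_eq_0[symmetric] less_2_cases_iff)
        then have "(q - h) * a mod q = q - u" by simp
        moreover have "root_of_unity_power q (h * a) = root_of_unity_power q u"
          using assms(1) by (simp add: u_def)
        ultimately show ?thesis
          using norm_geometric_sum_le[OF u, of B] False by (simp add: w_def u_def)
      qed (simp add: w_nonneg)
    qed
    also have "\<dots> = S h + S (q - h)" by (simp add: S_def sum.distrib)
    finally show ?thesis .
  qed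
  \<comment> \<open>The reflection sends \<open>h = 0\<close> to \<open>q\<close>, outside
    \<open>{..<q}\<close>; this is harmless because \<open>S q = 0\<close>.\<close>
  have S0: "S 0 = 0" "S q = 0" by (simp_all add: S_def w_def)
  have "(\<Sum>h<q. (S (q - h))\<^sup>2) \<le> (\<Sum>h<q. (S h)\<^sup>2)"
  proof -
    have "(\<Sum>h<q. (S (q - h))\<^sup>2) = (\<Sum>h = 1..q. (S h)\<^sup>2)"
      by (rule sum.reindex_bij_witness[of _ "\<lambda>h. q - h" "\<lambda>h. q - h"]) auto
    also have "\<dots> = (\<Sum>h = 1..<q. (S h)\<^sup>2)"
      using S0 by (intro sum.mono_neutral_right) (auto simp: less_le)
    also have "\<dots> \<le> (\<Sum>h<q. (S h)\<^sup>2)" by (rule sum_mono2) auto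
    finally show ?thesis .
  qed
  moreover have "real q * (\<Sum>x<q. (residue_discrepancy A B q x)\<^sup>2) = (\<Sum>h<q. (norm (F h))\<^sup>2)"
    unfolding F_def by (rule parseval_mod[OF assms(1), symmetric])
  moreover have "(\<Sum>h<q. (norm (F h))\<^sup>2) \<le> (\<Sum>h<q. 2 * (S h)\<^sup>2 + 2 * (S (q - h))\<^sup>2)"
  proof (rule sum_mono)
    fix h assume "h \<in> {..<q}"
    then have "(norm (F h))\<^sup>2 \<le> (S h + S (q - h))\<^sup>2"
      using norm_F by (intro power_mono) auto
    also have "\<dots> \<le> 2 * (S h)\<^sup>2 + 2 * (S (q - h))\<^sup>2"
      using sum_squares_bound[of "S h" "S (q - h)"] by (simp add: power2_sum)
    finally show "(norm (F h))\<^sup>2 \<le> 2 * (S h)\<^sup>2 + 2 * (S (q - h))\<^sup>2" .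
  qed
  ultimately have "real q * (\<Sum>x<q. (residue_discrepancy A B q x)\<^sup>2) \<le> 4 * (\<Sum>h<q. (S h)\<^sup>2)"
    by (simp add: sum.distrib flip: sum_distrib_left)
  also have "(\<Sum>h<q. (S h)\<^sup>2) \<le> D\<^sup>2 * real A * real q * harm q * (real B + real A * harm A)"
    using sum_weighted_residues_square_le[OF assms(1,2) D, where B = B] by (simp add: S_def w_def)
  finally have "real q * (\<Sum>x<q. (residue_discrepancy A B q x)\<^sup>2)
      \<le> real q * (4 * D\<^sup>2 * real A * harm q * (real B + real A * harm A))"
    by (simp add: mult_ac)
  then show ?thesis using assms(1) by (simp only: mult_le_cancel_left_pos of_nat_0_less_iff)
qed

subsection \<open>Summation over reduced residues\<close>

text \<open>As \<open>\<rho>\<close> is a unit, \<open>gcd r q\<close> must equal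
  \<open>g = gcd x q\<close>. There are at most \<open>R div g\<close> such \<open>r\<close>, being
  multiples of \<open>g\<close>, and each admits at most \<open>g\<close> values of
  \<open>\<rho>\<close>.\<close>

lemma card_product_mod_eq_le:
  fixes q R x :: nat
  assumes "q > 0"
  shows "card {(\<rho>, r). \<rho> \<in> {1..q} \<and> coprime \<rho> q \<and> r \<in> {1..R} \<and> \<rho> * r mod q = x} \<le> R"
proof -
  define g where "g = gcd x q"
  let ?fib = "\<lambda>r. {\<rho> \<in> {1..q}. \<rho> * r mod q = x}"
  have fib: "card (?fib r) \<le> gcd r q" for r
  proof -
    \<comment> \<open>Here \<open>\<rho>\<close> runs over \<open>{1..q}\<close> but the congruence
      count over \<open>{..<q}\<close>; reduction modulo \<open>q\<close> only moves
      \<open>q\<close> to \<open>0\<close>, so it is injective.\<close>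
    have "card (?fib r) \<le> card {h \<in> {..<q}. h * r mod q = x \<and> h * r mod q = x}"
    proof (rule card_inj_on_le[where f = "\<lambda>\<rho>. \<rho> mod q"])
      show "inj_on (\<lambda>\<rho>. \<rho> mod q) (?fib r)"
      proof (rule inj_onI)
        fix \<rho> \<rho>' assume *: "\<rho> \<in> ?fib r" "\<rho>' \<in> ?fib r" "\<rho> mod q = \<rho>' mod q"
        show "\<rho> = \<rho>'"
          using * by (cases "\<rho> = q"; cases "\<rho>' = q") auto
      qed
    qed (use assms in \<open>auto simp: mod_mult_left_eq\<close>)
    also have "\<dots> \<le> gcd (gcd r r) q" by (rule card_simultaneous_congruence_le[OF assms])
    finally show ?thesis by simp
  qed
  have "{(\<rho>, r). \<rho> \<in> {1..q} \<and> coprime \<rho> q \<and> r \<in> {1..R} \<and> \<rho> * r mod q = x}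
      \<subseteq> (\<lambda>(r, \<rho>). (\<rho>, r)) ` (SIGMA r : {r \<in> {1..R}. gcd r q = g}. ?fib r)"
  proof
    fix p assume "p \<in> {(\<rho>, r). \<rho> \<in> {1..q} \<and> coprime \<rho> q \<and> r \<in> {1..R} \<and> \<rho> * r mod q = x}"
    then obtain \<rho> r where p: "p = (\<rho>, r)"
      and *: "\<rho> \<in> {1..q}" "coprime \<rho> q" "r \<in> {1..R}" "x = \<rho> * r mod q" by auto
    have "g = gcd (\<rho> * r) q" using *(4) by (metis g_def gcd.commute gcd_red_nat)
    also have "\<dots> = gcd r q" using *(2)
      by (metis coprime_commute gcd.commute gcd_mult_left_left_cancel gcd_mult_right_left_cancel)
    finally have "gcd r q = g" by simp
    then show "p \<in> (\<lambda>(r, \<rho>). (\<rho>, r)) ` (SIGMA r : {r \<in> {1..R}. gcd r q = g}. ?fib r)"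
      using * p by force
  qed
  then have "card {(\<rho>, r). \<rho> \<in> {1..q} \<and> coprime \<rho> q \<and> r \<in> {1..R} \<and> \<rho> * r mod q = x}
      \<le> card (SIGMA r : {r \<in> {1..R}. gcd r q = g}. ?fib r)"
    by (rule surj_card_le[rotated]) auto
  also have "\<dots> = (\<Sum>r | r \<in> {1..R} \<and> gcd r q = g. card (?fib r))"
    by (subst card_SigmaI) auto
  also have "\<dots> \<le> (\<Sum>r | r \<in> {1..R} \<and> gcd r q = g. g)"
    by (rule sum_mono) (use fib in auto)
  also have "\<dots> \<le> (\<Sum>r | r \<in> {1..R} \<and> g dvd r. g)"
    by (rule sum_mono2) auto
  also have "\<dots> = g * (R div g)"
    using card_multiples[of R g] by simp
  also have "\<dots> \<le> R" by simp
  finally show ?thesis .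
qed

text \<open>Cauchy-Schwarz over \<open>r\<close> costs one factor \<open>R\<close>; the other bounds
  how often a residue \<open>x\<close> is hit by the products \<open>\<rho> * r\<close>.\<close>

lemma sum_coprime_sum_square_le:
  fixes f :: "nat \<Rightarrow> real"
  assumes "q > 0"
  shows "(\<Sum>\<rho> | 1 \<le> \<rho> \<and> \<rho> \<le> q \<and> coprime \<rho> q. (\<Sum>r = 1..R. f (\<rho> * r mod q))\<^sup>2)
           \<le> (real R)\<^sup>2 * (\<Sum>x<q. (f x)\<^sup>2)"
proof -
  define U where "U = {\<rho>. 1 \<le> \<rho> \<and> \<rho> \<le> q \<and> coprime \<rho> q}"
  define S where "S = U \<times> {1..R}"
  have "U \<subseteq> {1..q}" by (auto simp: U_def)
  then have "finite U" using finite_subset by blast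
  have "(\<Sum>\<rho>\<in>U. (\<Sum>r = 1..R. f (\<rho> * r mod q))\<^sup>2)
      \<le> (\<Sum>\<rho>\<in>U. (\<Sum>r = 1..R. (f (\<rho> * r mod q))\<^sup>2) * real R)"
    using sum_squared_le_sum_of_squares[of _ "{1..R}"] by (intro sum_mono) simp
  also have "\<dots> = real R * (\<Sum>p\<in>S. (f (fst p * snd p mod q))\<^sup>2)"
    by (simp add: S_def sum.cartesian_product case_prod_unfold mult.commute flip: sum_distrib_left)
  also have "(\<Sum>p\<in>S. (f (fst p * snd p mod q))\<^sup>2)
      = (\<Sum>x<q. \<Sum>p\<in>{p \<in> S. fst p * snd p mod q = x}. (f (fst p * snd p mod q))\<^sup>2)"
    by (rule sum.group[symmetric]) (use assms \<open>finite U\<close> in \<open>auto simp: S_def\<close>)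
  also have "\<dots> = (\<Sum>x<q. real (card {p \<in> S. fst p * snd p mod q = x}) * (f x)\<^sup>2)"
    by (intro sum.cong refl) simp
  also have "\<dots> \<le> (\<Sum>x<q. real R * (f x)\<^sup>2)"
  proof (intro sum_mono mult_right_mono)
    fix x
    have "{p \<in> S. fst p * snd p mod q = x}
        = {(\<rho>, r). \<rho> \<in> {1..q} \<and> coprime \<rho> q \<and> r \<in> {1..R} \<and> \<rho> * r mod q = x}"
      by (auto simp: S_def U_def)
    then show "real (card {p \<in> S. fst p * snd p mod q = x}) \<le> real R"
      using card_product_mod_eq_le[OF assms] by simp
  qed auto
  also have "real R * (\<Sum>x<q. real R * (f x)\<^sup>2) = (real R)\<^sup>2 * (\<Sum>x<q. (f x)\<^sup>2)"
    by (simp add: power2_eq_square mult.assoc flip: sum_distrib_left)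
  finally show ?thesis by (simp add: U_def mult_left_mono)
qed

text \<open>A reduced \<open>\<rho>\<close> does not affect divisibility by \<open>gcd a q\<close>,
  so each \<open>a\<close> contributes \<open>g * (R div g)\<close> with \<open>g = gcd a q\<close>,
  which differs from \<open>R\<close> by less than \<open>g\<close>. Summing these errors over
  \<open>a\<close> is a gcd sum.\<close>

lemma sum_expected_residue_count:
  assumes "q > 0" "coprime \<rho> q"
  shows "\<bar>(\<Sum>r = 1..R. expected_residue_count A B q (\<rho> * r)) - real A * real B * real R / real q\<bar>
           \<le> real A * real B * real (divisor_count q) / real q"
proof -
  have dvd: "gcd a q dvd \<rho> * r \<longleftrightarrow> gcd a q dvd r" for a r
    using assms(2) by (meson coprime_commute coprime_divisors coprime_dvd_mult_right_iff dvd_refl gcd_dvd2)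
  have inner: "(\<Sum>r = 1..R. if gcd a q dvd r then real (gcd a q) else 0) = real (gcd a q * (R div gcd a q))" for a
    using card_multiples[of R "gcd a q"] by (simp add: sum.If_cases Int_def mult.commute)
  have "(\<Sum>r = 1..R. expected_residue_count A B q (\<rho> * r))
      = real B / real q * (\<Sum>a = 1..A. \<Sum>r = 1..R. if gcd a q dvd r then real (gcd a q) else 0)"
    unfolding expected_residue_count_def dvd sum_distrib_left[symmetric]
    by (subst sum.swap) (rule refl)
  also have "\<dots> - real A * real B * real R / real q
      = real B / real q * (\<Sum>a = 1..A. real (gcd a q * (R div gcd a q)) - real R)"
    unfolding inner by (simp add: sum_subtractf algebra_simps)
  finally have "\<bar>(\<Sum>r = 1..R. expected_residue_count A B q (\<rho> * r)) - real A * real B * real R / real q\<bar>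
      = real B / real q * \<bar>\<Sum>a = 1..A. real (gcd a q * (R div gcd a q)) - real R\<bar>"
    by (simp add: abs_mult)
  also have "\<dots> \<le> real B / real q * (\<Sum>a = 1..A. real (gcd a q))"
  proof (rule mult_left_mono, rule order_trans[OF sum_abs], rule sum_mono)
    fix a
    have "gcd a q * (R div gcd a q) + R mod gcd a q = R" by simp
    moreover have "R mod gcd a q < gcd a q" using assms(1) by simp
    ultimately show "\<bar>real (gcd a q * (R div gcd a q)) - real R\<bar> \<le> real (gcd a q)" by linarith
  qed simp
  also have "\<dots> = real B / real q * real (\<Sum>a = 1..A. gcd a q)" by simp
  also have "\<dots> \<le> real B / real q * real (A * divisor_count q)"
    using sum_gcd_le[OF assms(1), of A] by (intro mult_left_mono) (simp_all only: of_nat_le_iff, simp)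
  also have "\<dots> = real A * real B * real (divisor_count q) / real q" by simp
  finally show ?thesis .
qed

section \<open>From sums over progressions to residue counts\<close>

lemma pos_and_le_iff_atLeastAtMost_floor:
  "0 < a \<and> real a \<le> y \<longleftrightarrow> a \<in> {1..nat \<lfloor>y\<rfloor>}"
proof
  assume "a \<in> {1..nat \<lfloor>y\<rfloor>}"
  then show "0 < a \<and> real a \<le> y" by simp linarith
qed (auto simp: le_nat_floor)

lemma tau_box_eq_card:
  "tau_box M N m = card {(a, b) \<in> {1..nat \<lfloor>M\<rfloor>} \<times> {1..nat \<lfloor>N\<rfloor>}. a * b = m}"
proof -
  have "{(a, b). 0 < a \<and> 0 < b \<and> real a \<le> M \<and> real b \<le> N \<and> a * b = m}
      = {(a, b) \<in> {1..nat \<lfloor>M\<rfloor>} \<times> {1..nat \<lfloor>N\<rfloor>}. a * b = m}"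
    using pos_and_le_iff_atLeastAtMost_floor by blast
  then show ?thesis by (simp add: tau_box_def)
qed

text \<open>Outside \<open>T\<close> the summand vanishes, since products from the box do not exceed
  \<open>A * B\<close>. The sum is thus finite, and grouping the pairs by their product turns it
  into a count.\<close>

lemma infsum_tau_box_class:
  "(\<Sum>\<^sub>\<infinity>m\<in>{m. 0 < m \<and> [m = x] (mod q)}. real (tau_box M N m))
     = real (product_residue_count (nat \<lfloor>M\<rfloor>) (nat \<lfloor>N\<rfloor>) q x)"
proof -
  define A B where "A = nat \<lfloor>M\<rfloor>" and "B = nat \<lfloor>N\<rfloor>"
  define S where "S = {(a, b) \<in> {1..A} \<times> {1..B}. [a * b = x] (mod q)}"
  define T where "T = {m \<in> {1..A * B}. [m = x] (mod q)}"
  have "S \<subseteq> {1..A} \<times> {1..B}" by (auto simp: S_def)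
  then have finS: "finite S" using finite_subset by blast
  have tau: "tau_box M N m = card {p \<in> S. fst p * snd p = m}" if "[m = x] (mod q)" for m
  proof -
    have "{(a, b) \<in> {1..A} \<times> {1..B}. a * b = m} = {p \<in> S. fst p * snd p = m}"
      using that by (auto simp: S_def)
    then show ?thesis by (simp add: tau_box_eq_card A_def B_def)
  qed
  have img: "(\<lambda>p. fst p * snd p) ` S \<subseteq> T"
    by (auto simp: S_def T_def Suc_le_eq mult_le_mono)
  have "(\<Sum>\<^sub>\<infinity>m\<in>{m. 0 < m \<and> [m = x] (mod q)}. real (tau_box M N m)) = (\<Sum>\<^sub>\<infinity>m\<in>T. real (tau_box M N m))"
  proof (rule infsum_cong_neutral)
    fix m assume m: "m \<in> {m. 0 < m \<and> [m = x] (mod q)} - T"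
    then have "{p \<in> S. fst p * snd p = m} = {}" using img by blast
    then show "real (tau_box M N m) = 0" using m by (simp add: tau del: Collect_empty_eq)
  qed (auto simp: T_def)
  also have "\<dots> = (\<Sum>m\<in>T. real (tau_box M N m))"
    by (rule infsum_finite) (simp add: T_def)
  also have "\<dots> = (\<Sum>m\<in>T. \<Sum>p\<in>{p \<in> S. fst p * snd p = m}. 1)"
    by (rule sum.cong) (simp_all add: T_def tau)
  also have "\<dots> = (\<Sum>p\<in>S. 1)"
    by (rule sum.group[OF finS _ img]) (simp add: T_def)
  also have "\<dots> = real (product_residue_count A B q x)"
    by (simp add: S_def product_residue_count_def)
  finally show ?thesis by (simp add: A_def B_def)
qed

lemma tau_progression_sum_eq:
  "tau_progression_sum M N K q \<rho> =
     (\<Sum>r = 1..nat \<lfloor>K\<rfloor>. real (product_residue_count (nat \<lfloor>M\<rfloor>) (nat \<lfloor>N\<rfloor>) q (\<rho> * r)))"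
proof -
  have "{r. 0 < r \<and> real r \<le> K} = {1..nat \<lfloor>K\<rfloor>}"
    using pos_and_le_iff_atLeastAtMost_floor by blast
  then show ?thesis by (simp add: tau_progression_sum_def infsum_tau_box_class)
qed

section \<open>Power bounds and assembly of the estimates\<close>

lemma sum_residue_discrepancy_square_le_powr:
  fixes c \<epsilon> :: real
  assumes "c > 0" "\<epsilon> > 0"
  obtains C where "C > 0"
    "\<And>A B q N. \<lbrakk>N \<ge> 1; A > 0; real A \<le> c * N; real B \<le> N; q > 0; real q \<le> N\<^sup>2\<rbrakk> \<Longrightarrow>
      (\<Sum>x<q. (residue_discrepancy A B q x)\<^sup>2) \<le> C * (N\<^sup>2 * N powr \<epsilon>)"
proof -
  \<comment> \<open>The mean square bound involves two divisor bounds and two harmonic sums, each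
    costing \<open>Y powr e\<close> with \<open>Y\<close> of order \<open>N ^ 3\<close>; together
    this is \<open>N\<close> to the power \<open>12 * e = \<epsilon>\<close>.\<close>
  define e where "e = \<epsilon> / 12"
  have "e > 0" using assms by (simp add: e_def)
  obtain Cd where Cd: "Cd \<ge> 1" "\<And>n. n > 0 \<Longrightarrow> real (divisor_count n) \<le> Cd * real n powr e"
    using divisor_count_le_powr[OF \<open>e > 0\<close>] by blast
  define Ch where "Ch = 1 + 1 / e"
  have "Ch > 0" using \<open>e > 0\<close> by (simp add: Ch_def add_pos_pos)
  define C where "C = 4 * Cd\<^sup>2 * c * Ch * (1 + c * Ch) * (c + 1) powr (4 * e)"
  have "C > 0" using Cd(1) \<open>Ch > 0\<close> assms by (simp add: C_def add_pos_pos)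
  moreover have "(\<Sum>x<q. (residue_discrepancy A B q x)\<^sup>2) \<le> C * (N\<^sup>2 * N powr \<epsilon>)"
    if N: "N \<ge> 1" and A: "A > 0" "real A \<le> c * N" and B: "real B \<le> N"
      and q: "q > 0" "real q \<le> N\<^sup>2" for A B q :: nat and N :: real
  proof -
    \<comment> \<open>A common bound for \<open>A\<close>, \<open>q\<close> and
      \<open>A * q\<close>, so that one \<open>P\<close> serves all divisor and harmonic
      bounds.\<close>
    define Y where "Y = (c + 1) * N ^ 3"
    define P where "P = Y powr e"
    have le_Y: "real A * real q \<le> Y"
    proof -
      have "real A * real q \<le> (c * N) * N\<^sup>2" using A q N by (intro mult_mono) auto
      also have "\<dots> \<le> Y" using N assms by (simp add: Y_def power2_eq_square power3_eq_cube algebra_simps)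
      finally show ?thesis .
    qed
    have "real A \<le> real A * real q" "real q \<le> real A * real q" using A(1) q(1) by simp_all
    then have le_Y': "real A \<le> Y" "real q \<le> Y" using le_Y by linarith+
    have "Y \<ge> 1" using le_Y'(1) A(1) by linarith
    then have "P \<ge> 1" using \<open>e > 0\<close> by (simp add: P_def ge_one_powr_ge_zero)
    have powr_le: "real n powr e \<le> P" if "real n \<le> Y" for n
      using that \<open>e > 0\<close> by (simp add: P_def powr_mono2)
    have D: "real (divisor_count n) \<le> Cd * P" if "n > 0" "n \<le> A * q" for n
    proof -
      have "real n \<le> Y" using that le_Y by (metis of_nat_le_iff of_nat_mult order_trans)
      then have "Cd * real n powr e \<le> Cd * P" using powr_le Cd(1) by (intro mult_left_mono) auto
      then show ?thesis using Cd(2)[OF \<open>n > 0\<close>] by linarith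
    qed
    have H: "harm n \<le> Ch * P" if "n > 0" "real n \<le> Y" for n
      using harm_le_powr[OF \<open>e > 0\<close> \<open>n > 0\<close>] powr_le[OF that(2)] \<open>Ch > 0\<close>
      by (smt (verit) Ch_def mult_left_mono)
    have "(\<Sum>x<q. (residue_discrepancy A B q x)\<^sup>2)
        \<le> 4 * (Cd * P)\<^sup>2 * real A * harm q * (real B + real A * harm A)"
      by (rule sum_residue_discrepancy_square_le[OF q(1) A(1) D])
    also have "\<dots> \<le> 4 * (Cd * P)\<^sup>2 * (c * N) * (Ch * P) * (N * P + (c * N) * (Ch * P))"
    proof -
      have "real B \<le> N * P"
        using B N \<open>P \<ge> 1\<close> mult_mono[of "real B" N 1 P] by simp
      then show ?thesis
        using A q B N assms \<open>Ch > 0\<close> \<open>P \<ge> 1\<close> H[OF A(1) le_Y'(1)] H[OF q(1) le_Y'(2)]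
        by (intro mult_mono add_mono) (auto simp: harm_nonneg)
    qed
    also have "\<dots> = 4 * Cd\<^sup>2 * c * Ch * (1 + c * Ch) * N\<^sup>2 * P ^ 4"
      by (simp add: power2_eq_square power4_eq_xxxx algebra_simps)
    also have "P ^ 4 = Y powr (4 * e)"
      using \<open>Y \<ge> 1\<close> by (simp add: P_def powr_powr mult.commute flip: powr_realpow)
    also have "\<dots> = (c + 1) powr (4 * e) * (N powr 3) powr (4 * e)"
      using N assms by (simp add: Y_def powr_mult)
    also have "(N powr 3) powr (4 * e) = N powr \<epsilon>"
      by (simp add: powr_powr e_def)
    finally show ?thesis by (simp add: C_def mult_ac)
  qed
  ultimately show ?thesis using that by blast
qed

text \<open>The floors are inserted one factor at a time; each of the three differences carries one
  rounding error of at most \<open>1\<close>.\<close>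

lemma main_term_floor_error:
  fixes K M N :: real
  assumes "K \<ge> 0" "M \<ge> 0" "N \<ge> 0"
  shows "\<bar>real (nat \<lfloor>M\<rfloor>) * real (nat \<lfloor>N\<rfloor>) * real (nat \<lfloor>K\<rfloor>) - K * M * N\<bar> \<le> M * N + K * (M + N)"
proof -
  define a b r where "a = real (nat \<lfloor>M\<rfloor>)" and "b = real (nat \<lfloor>N\<rfloor>)" and "r = real (nat \<lfloor>K\<rfloor>)"
  have bounds: "0 \<le> a" "a \<le> M" "M \<le> a + 1" "0 \<le> b" "b \<le> N" "N \<le> b + 1" "0 \<le> r" "r \<le> K" "K \<le> r + 1"
    using assms unfolding a_def b_def r_def by linarith+
  have "a * b * r \<le> M * N * K"
    using bounds assms by (intro mult_mono) auto
  moreover have "(K - r) * (M * N) \<le> 1 * (M * N)" using bounds assms by (intro mult_right_mono) auto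
  moreover have "r * ((M - a) * N) \<le> K * (1 * N)" using bounds assms by (intro mult_mono) auto
  moreover have "r * (a * (N - b)) \<le> K * (M * 1)" using bounds assms by (intro mult_mono) auto
  moreover have "K * M * N - a * b * r = (K - r) * (M * N) + r * ((M - a) * N) + r * (a * (N - b))"
    by (simp add: algebra_simps)
  ultimately show ?thesis unfolding a_def[symmetric] b_def[symmetric] r_def[symmetric]
    by (simp add: algebra_simps)
qed

text \<open>The deviation splits into the discrepancy part \<open>X\<close>, treated in mean square,
  and the error \<open>y\<close> of the expected count, treated pointwise. As \<open>y\<close>
  carries a factor \<open>1 / q\<close> and there are at most \<open>q\<close> reduced residues, its
  squares contribute with \<open>1 / q\<close>.\<close>

lemma sum_tau_progression_variance_le:
  fixes M N K :: real and q :: nat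
  assumes "M \<ge> 0" "N \<ge> 0" "K \<ge> 0" "q > 0"
  shows "(\<Sum>\<rho> | 1 \<le> \<rho> \<and> \<rho> \<le> q \<and> coprime \<rho> q.
            (tau_progression_sum M N K q \<rho> - K * M * N / real q)\<^sup>2)
      \<le> 2 * K\<^sup>2 * (\<Sum>x<q. (residue_discrepancy (nat \<lfloor>M\<rfloor>) (nat \<lfloor>N\<rfloor>) q x)\<^sup>2)
        + 16 * (M * N * real (divisor_count q))\<^sup>2 / real q + 4 * (K * (M + N))\<^sup>2 / real q"
proof -
  define A B R where "A = nat \<lfloor>M\<rfloor>" and "B = nat \<lfloor>N\<rfloor>" and "R = nat \<lfloor>K\<rfloor>"
  define d where "d = real (divisor_count q)"
  define U where "U = {\<rho>. 1 \<le> \<rho> \<and> \<rho> \<le> q \<and> coprime \<rho> q}"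
  define \<Delta> where "\<Delta> = residue_discrepancy A B q"
  define X where "X \<rho> = (\<Sum>r = 1..R. \<Delta> (\<rho> * r mod q))" for \<rho>
  \<comment> \<open>Bound for \<open>y\<^sup>2\<close>, from
    \<open>(s + t)\<^sup>2 \<le> 2 * s\<^sup>2 + 2 * t\<^sup>2\<close> with
    \<open>s = 2 * M * N * d / q\<close> and \<open>t = K * (M + N) / q\<close>. The
    \<open>2\<close> in \<open>s\<close> covers both the gcd errors and the rounding of
    \<open>K\<close>, since \<open>d \<ge> 1\<close>.\<close>
  define E where "E = 8 * (M * N * d)\<^sup>2 / (real q)\<^sup>2 + 2 * (K * (M + N))\<^sup>2 / (real q)\<^sup>2"
  have "U \<subseteq> {1..q}" by (auto simp: U_def)
  then have "card U \<le> q" using card_mono[of "{1..q}" U] by simp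
  have floors: "real A \<le> M" "real B \<le> N" "real R \<le> K"
    using assms by (auto simp: A_def B_def R_def)
  have "divisor_count q \<noteq> 0"
    using assms(4) unfolding divisor_count_def by (subst card_0_eq) auto
  then have "d \<ge> 1" by (simp add: d_def Suc_le_eq)
  have "E \<ge> 0" by (simp add: E_def)
  have pointwise: "(tau_progression_sum M N K q \<rho> - K * M * N / real q)\<^sup>2 \<le> 2 * (X \<rho>)\<^sup>2 + 2 * E"
    if "\<rho> \<in> U" for \<rho>
  proof -
    define y where "y = (\<Sum>r = 1..R. expected_residue_count A B q (\<rho> * r)) - K * M * N / real q"
    have split: "tau_progression_sum M N K q \<rho> - K * M * N / real q = X \<rho> + y"
    proof -
      have "X \<rho> = (\<Sum>r = 1..R. \<Delta> (\<rho> * r))"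
        by (simp only: X_def \<Delta>_def residue_discrepancy_mod)
      then show ?thesis
        by (simp add: tau_progression_sum_eq A_def B_def R_def y_def \<Delta>_def sum_subtractf)
    qed
    have "\<bar>real A * real B * real R / real q - K * M * N / real q\<bar> \<le> (M * N + K * (M + N)) / real q"
      using main_term_floor_error[OF assms(3,1,2)] assms(4)
      by (simp add: A_def B_def R_def divide_right_mono flip: diff_divide_distrib)
    moreover have "\<bar>(\<Sum>r = 1..R. expected_residue_count A B q (\<rho> * r)) - real A * real B * real R / real q\<bar>
        \<le> real A * real B * d / real q"
      using sum_expected_residue_count[OF assms(4)] that by (simp add: U_def d_def)
    moreover have "real A * real B * d / real q \<le> M * N * d / real q"
      using floors assms \<open>d \<ge> 1\<close> by (intro divide_right_mono mult_mono) auto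
    moreover have "M * N / real q \<le> M * N * d / real q"
      using assms \<open>d \<ge> 1\<close> mult_left_mono[of 1 d "M * N"] by (intro divide_right_mono) auto
    ultimately have "\<bar>y\<bar> \<le> 2 * (M * N * d / real q) + K * (M + N) / real q"
      by (simp add: y_def add_divide_distrib)
    then have "y\<^sup>2 \<le> (2 * (M * N * d / real q) + K * (M + N) / real q)\<^sup>2"
      by (metis abs_ge_zero power2_abs power_mono)
    also have "\<dots> \<le> 2 * (2 * (M * N * d / real q))\<^sup>2 + 2 * (K * (M + N) / real q)\<^sup>2"
      using sum_squares_bound[of "2 * (M * N * d / real q)" "K * (M + N) / real q"]
      by (simp add: power2_sum)
    also have "\<dots> = E" by (simp add: E_def power_divide power_mult_distrib)
    finally have "y\<^sup>2 \<le> E" .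
    then show ?thesis
      unfolding split using sum_squares_bound[of "X \<rho>" y] by (simp add: power2_sum)
  qed
  have "(\<Sum>\<rho>\<in>U. (tau_progression_sum M N K q \<rho> - K * M * N / real q)\<^sup>2)
      \<le> (\<Sum>\<rho>\<in>U. 2 * (X \<rho>)\<^sup>2 + 2 * E)"
    by (rule sum_mono) (rule pointwise)
  also have "\<dots> = 2 * (\<Sum>\<rho>\<in>U. (X \<rho>)\<^sup>2) + real (card U) * (2 * E)"
    by (simp add: sum.distrib flip: sum_distrib_left)
  also have "\<dots> \<le> 2 * ((real R)\<^sup>2 * (\<Sum>x<q. (\<Delta> x)\<^sup>2)) + real q * (2 * E)"
    using sum_coprime_sum_square_le[OF assms(4), of \<Delta> R] \<open>card U \<le> q\<close> \<open>E \<ge> 0\<close>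
    by (intro add_mono mult_left_mono mult_right_mono) (auto simp: X_def U_def)
  also have "\<dots> \<le> 2 * (K\<^sup>2 * (\<Sum>x<q. (\<Delta> x)\<^sup>2)) + real q * (2 * E)"
    using floors by (intro add_mono mult_left_mono mult_right_mono power_mono) (auto intro: sum_nonneg)
  also have "real q * (2 * E) = 16 * (M * N * d)\<^sup>2 / real q + 4 * (K * (M + N))\<^sup>2 / real q"
    using assms(4) by (simp add: E_def power2_eq_square field_simps)
  finally show ?thesis
    by (simp add: U_def \<Delta>_def A_def B_def d_def mult.assoc)
qed

theorem theorem1p9:
  fixes C\<^sub>1 C\<^sub>2 \<eta> \<delta> \<epsilon> :: real
  assumes "C\<^sub>1 > 0" and "C\<^sub>2 > 0" and "\<eta> > 0" and "\<delta> > 0" and "\<epsilon> > 0"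
  shows "\<exists>C>0. \<forall>(M::real) (N::real) (K::real) (q::nat).
      M \<ge> 1 \<longrightarrow> N \<ge> 1 \<longrightarrow> C\<^sub>1 * N \<le> M \<longrightarrow> M \<le> C\<^sub>2 * N \<longrightarrow> q \<ge> 1 \<longrightarrow>
      K \<ge> N powr \<eta> \<longrightarrow> real q \<le> N powr (2 - \<delta>) \<longrightarrow>
      (\<Sum>\<rho> | 1 \<le> \<rho> \<and> \<rho> \<le> q \<and> coprime \<rho> q.
          (tau_progression_sum M N K q \<rho> - K * M * N / real q)\<^sup>2)
        \<le> C * (K\<^sup>2 * N ^ 4 / real q *
             (real q powr \<epsilon> * (1 / real q + 1 / K)\<^sup>2
               + N powr (max (- 1 / 2) (- \<delta>) + \<epsilon>)))"
proof -
  obtain Cv where Cv: "Cv > 0"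
    "\<And>A B q N. \<lbrakk>N \<ge> 1; A > 0; real A \<le> C\<^sub>2 * N; real B \<le> N; q > 0; real q \<le> N\<^sup>2\<rbrakk> \<Longrightarrow>
      (\<Sum>x<q. (residue_discrepancy A B q x)\<^sup>2) \<le> Cv * (N\<^sup>2 * N powr \<epsilon>)"
    using sum_residue_discrepancy_square_le_powr[OF \<open>C\<^sub>2 > 0\<close> \<open>\<epsilon> > 0\<close>] by blast
  obtain Cd where Cd: "Cd \<ge> 1"
    "\<And>n. n > 0 \<Longrightarrow> real (divisor_count n) \<le> Cd * real n powr (\<epsilon> / 2)"
    using divisor_count_le_powr[of "\<epsilon> / 2"] \<open>\<epsilon> > 0\<close> by auto
  \<comment> \<open>One summand for each term of the variance bound: discrepancy, divisors and
    rounding.\<close>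
  define C where "C = 2 * Cv + 16 * C\<^sub>2\<^sup>2 * Cd\<^sup>2 + 4 * (C\<^sub>2 + 1)\<^sup>2"
  have "C > 0" using Cv(1) by (simp add: C_def add_pos_nonneg)
  moreover have "(\<Sum>\<rho> | 1 \<le> \<rho> \<and> \<rho> \<le> q \<and> coprime \<rho> q.
        (tau_progression_sum M N K q \<rho> - K * M * N / real q)\<^sup>2)
      \<le> C * (K\<^sup>2 * N ^ 4 / real q *
           (real q powr \<epsilon> * (1 / real q + 1 / K)\<^sup>2 + N powr (max (- 1 / 2) (- \<delta>) + \<epsilon>)))"
    if M: "M \<ge> 1" "M \<le> C\<^sub>2 * N" and N: "N \<ge> 1" and q: "q \<ge> 1" "real q \<le> N powr (2 - \<delta>)"
      and K: "K \<ge> N powr \<eta>" for M N K :: real and q :: nat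
  proof -
    define G where "G = K\<^sup>2 * N ^ 4 / real q"
    define P where "P = real q powr \<epsilon> * (1 / real q + 1 / K)\<^sup>2"
    define Q where "Q = N powr (max (- 1 / 2) (- \<delta>) + \<epsilon>)"
    have "K \<ge> 1" using K N ge_one_powr_ge_zero[of N \<eta>] \<open>\<eta> > 0\<close> by linarith
    have nonneg: "G \<ge> 0" "P \<ge> 0" "Q \<ge> 0" by (simp_all add: G_def P_def Q_def)
    have "N powr (2 - \<delta>) \<le> N powr 2" using N \<open>\<delta> > 0\<close> by (intro powr_mono) auto
    then have q_le: "real q \<le> N\<^sup>2" using q N by simp
    \<comment> \<open>By \<open>q \<le> N powr (2 - \<delta>)\<close>, \<open>N\<^sup>2\<close> is
      at most \<open>N ^ 4 / q\<close> times \<open>N powr (- \<delta>)\<close>; this is the source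
      of the exponent \<open>- \<delta>\<close>.\<close>
    have term1: "K\<^sup>2 * (N\<^sup>2 * N powr \<epsilon>) \<le> G * Q"
    proof -
      have "real q * (N\<^sup>2 * N powr \<epsilon>) \<le> N powr (2 - \<delta>) * (N powr 2 * N powr \<epsilon>)"
        using q N by (intro mult_mono) auto
      also have "\<dots> = N powr (4 - \<delta> + \<epsilon>)" by (simp add: algebra_simps flip: powr_add)
      also have "\<dots> \<le> N powr (4 + (max (- 1 / 2) (- \<delta>) + \<epsilon>))" using N by (intro powr_mono) auto
      also have "\<dots> = N ^ 4 * Q" unfolding powr_add[of N 4] using N by (simp add: Q_def)
      finally have "N\<^sup>2 * N powr \<epsilon> \<le> N ^ 4 * Q / real q" using q by (simp add: field_simps)
      then have "K\<^sup>2 * (N\<^sup>2 * N powr \<epsilon>) \<le> K\<^sup>2 * (N ^ 4 * Q / real q)" by (rule mult_left_mono) simp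
      then show ?thesis by (simp add: G_def mult_ac)
    qed
    \<comment> \<open>Squaring the divisor bound with exponent \<open>\<epsilon> / 2\<close> gives
      \<open>q powr \<epsilon>\<close>. The factor \<open>K\<^sup>2\<close> in \<open>G\<close> is
      balanced by \<open>(1 / K)\<^sup>2\<close>, and
      \<open>1 / K \<le> 1 / q + 1 / K\<close>.\<close>
    have term2: "(M * N * real (divisor_count q))\<^sup>2 / real q \<le> C\<^sub>2\<^sup>2 * Cd\<^sup>2 * (G * P)"
    proof -
      have "(M * N * real (divisor_count q))\<^sup>2 \<le> ((C\<^sub>2 * N) * N * (Cd * real q powr (\<epsilon> / 2)))\<^sup>2"
        using M N q Cd \<open>C\<^sub>2 > 0\<close> by (intro power_mono mult_mono) auto
      also have "\<dots> = C\<^sub>2\<^sup>2 * Cd\<^sup>2 * (N ^ 4 * real q powr \<epsilon>)"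
        by (simp add: power2_eq_square power4_eq_xxxx mult_ac flip: powr_add)
      finally have "(M * N * real (divisor_count q))\<^sup>2 / real q \<le> C\<^sub>2\<^sup>2 * Cd\<^sup>2 * (N ^ 4 * real q powr \<epsilon>) / real q"
        by (rule divide_right_mono) simp
      also have "\<dots> = C\<^sub>2\<^sup>2 * Cd\<^sup>2 * (G * (real q powr \<epsilon> * (1 / K)\<^sup>2))"
        using \<open>K \<ge> 1\<close> by (simp add: G_def power_divide)
      also have "\<dots> \<le> C\<^sub>2\<^sup>2 * Cd\<^sup>2 * (G * P)"
        unfolding P_def using \<open>G \<ge> 0\<close> \<open>K \<ge> 1\<close>
        by (intro mult_left_mono power_mono) auto
      finally show ?thesis .
    qed
    \<comment> \<open>The term has order \<open>K\<^sup>2 * N\<^sup>2 / q\<close>. The maximum in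
      the exponent of \<open>Q\<close> is at least \<open>-1/2\<close>, so
      \<open>N\<^sup>2 * Q \<ge> 1\<close> and the term is absorbed by \<open>G * Q\<close>.\<close>
    have term3: "(K * (M + N))\<^sup>2 / real q \<le> (C\<^sub>2 + 1)\<^sup>2 * (G * Q)"
    proof -
      have "N\<^sup>2 * 1 \<le> N\<^sup>2 * N powr (2 + (max (- 1 / 2) (- \<delta>) + \<epsilon>))"
        using N \<open>\<epsilon> > 0\<close> by (intro mult_left_mono ge_one_powr_ge_zero) auto
      also have "\<dots> = N ^ 4 * Q"
        unfolding powr_add[of N 2] using N by (simp add: Q_def power2_eq_square power4_eq_xxxx)
      finally have "N\<^sup>2 \<le> N ^ 4 * Q" by simp
      have "(K * (M + N))\<^sup>2 \<le> (K * ((C\<^sub>2 + 1) * N))\<^sup>2"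
        using M N \<open>K \<ge> 1\<close> by (intro power_mono mult_left_mono) (auto simp: algebra_simps)
      also have "\<dots> = (C\<^sub>2 + 1)\<^sup>2 * K\<^sup>2 * N\<^sup>2" by (simp add: power_mult_distrib mult_ac)
      also have "\<dots> \<le> (C\<^sub>2 + 1)\<^sup>2 * K\<^sup>2 * (N ^ 4 * Q)"
        using \<open>N\<^sup>2 \<le> N ^ 4 * Q\<close> by (intro mult_left_mono) auto
      finally have "(K * (M + N))\<^sup>2 / real q \<le> (C\<^sub>2 + 1)\<^sup>2 * K\<^sup>2 * (N ^ 4 * Q) / real q"
        by (rule divide_right_mono) simp
      then show ?thesis by (simp add: G_def mult_ac)
    qed
    have V: "(\<Sum>x<q. (residue_discrepancy (nat \<lfloor>M\<rfloor>) (nat \<lfloor>N\<rfloor>) q x)\<^sup>2) \<le> Cv * (N\<^sup>2 * N powr \<epsilon>)"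
    proof (rule Cv(2))
      show "real (nat \<lfloor>M\<rfloor>) \<le> C\<^sub>2 * N" using M of_nat_floor[of M] by linarith
      show "real (nat \<lfloor>N\<rfloor>) \<le> N" using N of_nat_floor[of N] by linarith
      show "0 < nat \<lfloor>M\<rfloor>" using M by simp
    qed (use N q q_le in auto)
    have "(\<Sum>\<rho> | 1 \<le> \<rho> \<and> \<rho> \<le> q \<and> coprime \<rho> q.
          (tau_progression_sum M N K q \<rho> - K * M * N / real q)\<^sup>2)
        \<le> 2 * K\<^sup>2 * (\<Sum>x<q. (residue_discrepancy (nat \<lfloor>M\<rfloor>) (nat \<lfloor>N\<rfloor>) q x)\<^sup>2)
          + 16 * (M * N * real (divisor_count q))\<^sup>2 / real q + 4 * (K * (M + N))\<^sup>2 / real q"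
      using M N \<open>K \<ge> 1\<close> q by (intro sum_tau_progression_variance_le) auto
    also have "\<dots> \<le> 2 * Cv * (G * Q) + 16 * (C\<^sub>2\<^sup>2 * Cd\<^sup>2 * (G * P)) + 4 * ((C\<^sub>2 + 1)\<^sup>2 * (G * Q))"
    proof (intro add_mono)
      have "K\<^sup>2 * (\<Sum>x<q. (residue_discrepancy (nat \<lfloor>M\<rfloor>) (nat \<lfloor>N\<rfloor>) q x)\<^sup>2)
          \<le> K\<^sup>2 * (Cv * (N\<^sup>2 * N powr \<epsilon>))" using V by (rule mult_left_mono) simp
      also have "\<dots> = Cv * (K\<^sup>2 * (N\<^sup>2 * N powr \<epsilon>))" by simp
      also have "\<dots> \<le> Cv * (G * Q)" using term1 Cv(1) by (intro mult_left_mono) auto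
      finally show "2 * K\<^sup>2 * (\<Sum>x<q. (residue_discrepancy (nat \<lfloor>M\<rfloor>) (nat \<lfloor>N\<rfloor>) q x)\<^sup>2)
          \<le> 2 * Cv * (G * Q)" by (simp add: mult.assoc)
    qed (use term2 term3 in simp_all)
    also have "\<dots> \<le> C * (G * P + G * Q)"
    proof -
      have "16 * (C\<^sub>2\<^sup>2 * Cd\<^sup>2 * (G * P)) \<le> C * (G * P)"
        using nonneg Cv(1) unfolding mult.assoc[symmetric] C_def by (intro mult_right_mono) auto
      moreover have "(2 * Cv + 4 * (C\<^sub>2 + 1)\<^sup>2) * (G * Q) \<le> C * (G * Q)"
        using nonneg unfolding C_def by (intro mult_right_mono) auto
      ultimately show ?thesis by (simp add: algebra_simps)
    qed
    also have "\<dots> = C * (G * (P + Q))" by (simp add: distrib_left)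
    finally show ?thesis by (simp add: G_def P_def Q_def)
  qed
  ultimately show ?thesis by blast
qed

end
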